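(* Let $O(n,m)$ be the number (up to isomorphism) of 2-graphs $(\Lambda,d)$ with a single vertex for which $|d^{-1}((1,0))|=n$ and $|d^{-1}((0,1))|=m$. Then $$O(2,2)=9,\qquad O(2,3)=84,\qquad O(3,4)=3{,}333{,}212.$$
   Context: A single vertex 2-graph with $|d^{-1}((1,0))|=n$ and $|d^{-1}((0,1))|=m$ is identified with a unital semigroup $\mathbb F_n^+\times_\theta\mathbb F_m^+$, where $\theta$ is a permutation of $\{1,\dots,n\}\times\{1,\dots,m\}$: it is generated by $e_1,\dots,e_n,f_1,\dots,f_m$ subject only to the relations $e_if_j=f_{j'}e_{i'}$ whenever $\theta(i,j)=(i',j')$. The degree map $d$ into $\mathbb Z_+^2$ counts the number of $e$'s and of $f$'s in an element. Two such 2-graphs are counted as the same if these semigroups are isomorphic as (ungraded) unital semigroups. For $n\ne m$ this amounts to counting permutations $\theta\in S_{nm}$ up to conjugation by elements of $S_n\times S_m$; for $n=m$ exchange of the two generator sets is also allowed. *)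

theory Defs
  imports "HOL-Algebra.Group" "HOL-Combinatorics.Permutations"
begin

datatype gen = Gen_e nat | Gen_f nat

definition words :: "nat \<Rightarrow> nat \<Rightarrow> gen list set" where
  "words n m = lists (Gen_e ` {1..n} \<union> Gen_f ` {1..m})"

text \<open>One application of a defining relation e_i f_j = f_j' e_i', where (i', j') is the image
  of (i, j) under the permutation, inside a word.\<close>

inductive commutation_step ::
    "nat \<Rightarrow> nat \<Rightarrow> (nat \<times> nat \<Rightarrow> nat \<times> nat) \<Rightarrow> gen list \<Rightarrow> gen list \<Rightarrow> bool"
  for n m \<theta> where
  "\<lbrakk> u \<in> words n m; v \<in> words n m; i \<in> {1..n}; j \<in> {1..m}; \<theta> (i, j) = (i', j') \<rbrakk>
    \<Longrightarrow> commutation_step n m \<theta> (u @ [Gen_e i, Gen_f j] @ v) (u @ [Gen_f j', Gen_e i'] @ v)"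

definition word_cong ::
    "nat \<Rightarrow> nat \<Rightarrow> (nat \<times> nat \<Rightarrow> nat \<times> nat) \<Rightarrow> (gen list \<times> gen list) set" where
  "word_cong n m \<theta> =
    {(w, w'). w \<in> words n m \<and> w' \<in> words n m \<and> equivclp (commutation_step n m \<theta>) w w'}"

text \<open>The unital semigroup presented by the generators and the commutation relations. The union
  in the product is a single congruence class when X and Y are congruence classes.\<close>

definition theta_semigroup ::
    "nat \<Rightarrow> nat \<Rightarrow> (nat \<times> nat \<Rightarrow> nat \<times> nat) \<Rightarrow> gen list set monoid" where
  "theta_semigroup n m \<theta> =
    \<lparr> carrier = words n m // word_cong n m \<theta>,
      monoid.mult = (\<lambda>X Y. \<Union>x\<in>X. \<Union>y\<in>Y. word_cong n m \<theta> `` {x @ y}),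
      one = word_cong n m \<theta> `` {[]} \<rparr>"

fun is_gen_e :: "gen \<Rightarrow> bool" where
  "is_gen_e (Gen_e i) = True"
| "is_gen_e (Gen_f j) = False"

definition word_degree :: "gen list \<Rightarrow> nat \<times> nat" where
  "word_degree w = (length (filter is_gen_e w), length (filter (\<lambda>g. \<not> is_gen_e g) w))"

text \<open>All words in a congruence class have the same degree, so the choice of representative is
  immaterial.\<close>

definition class_degree :: "gen list set \<Rightarrow> nat \<times> nat" where
  "class_degree X = word_degree (SOME w. w \<in> X)"

type_synonym graph2 = "gen list set monoid \<times> (gen list set \<Rightarrow> nat \<times> nat)"

definition degree_fibre :: "graph2 \<Rightarrow> nat \<times> nat \<Rightarrow> gen list set set" where
  "degree_fibre G p = {x \<in> carrier (fst G). snd G x = p}"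

text \<open>Single vertex 2-graphs with finitely many edges of each colour, identified with the
  semigroups above and their degree maps. The predicate permutes makes each permutation the
  identity outside the index grid.\<close>

definition single_vertex_2graph :: "graph2 \<Rightarrow> bool" where
  "single_vertex_2graph G \<longleftrightarrow>
    (\<exists>N M \<theta>. \<theta> permutes ({1..N} \<times> {1..M}) \<and> G = (theta_semigroup N M \<theta>, class_degree))"

definition single_vertex_2graphs :: "nat \<Rightarrow> nat \<Rightarrow> graph2 set" where
  "single_vertex_2graphs n m =
    {G. single_vertex_2graph G \<and>
        finite (degree_fibre G (1, 0)) \<and> card (degree_fibre G (1, 0)) = n \<and>
        finite (degree_fibre G (0, 1)) \<and> card (degree_fibre G (0, 1)) = m}"

text \<open>Isomorphism is ungraded: only the semigroups are compared. A bijective multiplicative map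
  between monoids preserves the unit, so the isomorphisms of HOL-Algebra are unital.\<close>

definition graph2_iso :: "nat \<Rightarrow> nat \<Rightarrow> (graph2 \<times> graph2) set" where
  "graph2_iso n m =
    {(G, G'). G \<in> single_vertex_2graphs n m \<and> G' \<in> single_vertex_2graphs n m \<and> fst G \<cong> fst G'}"

definition O_count :: "nat \<Rightarrow> nat \<Rightarrow> nat" where
  "O_count n m = card (single_vertex_2graphs n m // graph2_iso n m)"

end

theory Submission
  imports Defs "HOL-Combinatorics.Cycles" "HOL-Combinatorics.Orbits"
    "HOL-Algebra.Group_Action" "HOL-Library.Multiset"
begin

text \<open>
  In the semigroup of \<open>\<theta>\<close> the generators are the elements that are not units and not products
  of two non-units, so an isomorphism maps generators to generators. A product of two generators
  has a second factorisation into generators iff their colours differ, and then the two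
  factorisations are the sides of a relation \<open>e\<^sub>i f\<^sub>j = f\<^sub>j\<^sub>' e\<^sub>i\<^sub>'\<close>; hence an isomorphism
  preserves the two colours or exchanges them, and the latter forces \<open>n = m\<close>.
  If it sends \<open>e\<^sub>i\<close> to \<open>e\<^bsub>\<alpha> i\<^esub>\<close> and \<open>f\<^sub>j\<close> to \<open>f\<^bsub>\<beta> j\<^esub>\<close>, comparing relations gives
  \<open>\<theta>' = \<tau> \<theta> \<tau>\<inverse>\<close> with \<open>\<tau> = \<alpha> \<times> \<beta>\<close>. If it sends \<open>e\<^sub>i\<close> to \<open>f\<^bsub>\<alpha> i\<^esub>\<close> and \<open>f\<^sub>j\<close> to \<open>e\<^bsub>\<beta> j\<^esub>\<close>, both sides of
  the relation are reversed, and the condition becomes \<open>\<theta>' = \<tau> \<theta>\<inverse> \<tau>\<inverse>\<close> with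
  \<open>\<tau> (i, j) = (\<beta> j, \<alpha> i)\<close>. Conversely each such \<open>\<tau>\<close> induces an isomorphism. This is
  \<open>semigroup_iso_iff\<close>.

  Isomorphism classes are therefore the orbits of a finite group of signed permutations \<open>(s, \<tau>)\<close>
  of the index grid, the sign telling whether \<open>\<theta>\<close> is inverted, and Burnside's lemma counts them
  (\<open>O_count_burnside\<close>). The elements fixed by \<open>(False, \<tau>)\<close> form the centralizer of \<open>\<tau>\<close>, whose order is
  the product of \<open>k ^ c * c!\<close> over all \<open>k\<close>, where \<open>c\<close> is the number of \<open>k\<close>-cycles
  (\<open>card_commutants\<close>). The cycles of \<open>\<alpha> \<times> \<beta>\<close> are read off from
  those of \<open>\<alpha>\<close> and \<open>\<beta>\<close>, because the period of \<open>(i, j)\<close> is the least common multiple of the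
  periods of \<open>i\<close> and \<open>j\<close>. So only the cycle types occurring in the symmetric groups on at most
  four points matter. The sums over the relabellings are 48 for (2, 2), 1008 for
  (2, 3) and 479982528 for (3, 4); the four exchanges for (2, 2) contribute another
  10 + 10 + 2 + 2 = 24 fixed points. Division by the group orders 8, 12 and 144 gives the claim.
\<close>

section \<open>Permutations commuting with a given permutation\<close>

text \<open>The prefix \<open>inv\<close> denotes inverses in an abstract group here, so the inverse of a
  permutation needs a name of its own.\<close>

abbreviation perm_inv :: "('a \<Rightarrow> 'a) \<Rightarrow> 'a \<Rightarrow> 'a" where
  "perm_inv p \<equiv> inv_into UNIV p"

lemma perm_restrict_permutes:
  assumes "inj_on f A" "f ` A \<subseteq> A" "finite A"
  shows "perm_restrict f A permutes A"
proof (rule bij_imp_permutes)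
  have "bij_betw f A A" using assms by (simp add: bij_betw_def endo_inj_surj)
  then show "bij_betw (perm_restrict f A) A A"
    by (rule bij_betw_cong[THEN iffD2, rotated]) (simp add: perm_restrict_def)
qed (simp add: perm_restrict_def)

definition commutants :: "('a \<Rightarrow> 'a) \<Rightarrow> 'a set \<Rightarrow> ('a \<Rightarrow> 'a) set" where
  "commutants h S = {\<pi>. \<pi> permutes S \<and> \<pi> \<circ> h = h \<circ> \<pi>}"

text \<open>A \<open>k\<close>-cycle consists of \<open>k\<close> points of period \<open>k\<close>, whence the division.\<close>

definition cycle_count :: "('a \<Rightarrow> 'a) \<Rightarrow> 'a set \<Rightarrow> nat \<Rightarrow> nat" where
  "cycle_count h S k = card {x \<in> S. least_power h x = k} div k"

text \<open>Which powers of \<open>h\<close> agree at a point depends only on the period of the point. This makes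
  the assignment of the \<open>i\<close>-th iterate of \<open>a\<close> to the \<open>i\<close>-th iterate of \<open>b\<close> well defined.\<close>

lemma funpow_eq_transfer:
  assumes h: "permutation h" and eq: "least_power h a = least_power h b"
    and ij: "(h ^^ i) a = (h ^^ j) a"
  shows "(h ^^ i) b = (h ^^ j) b"
proof -
  have inj: "inj (h ^^ n)" for n
    using h permutation_bijective bij_is_inj inj_fn by blast
  have *: "(h ^^ i) b = (h ^^ j) b" if "i \<le> j" "(h ^^ i) a = (h ^^ j) a" for i j
  proof -
    have split: "(h ^^ j) x = (h ^^ i) ((h ^^ (j - i)) x)" for x
      using that(1) by (metis comp_apply funpow_add le_add_diff_inverse)
    have "(h ^^ (j - i)) a = a"
      using that(2) split injD[OF inj] by metis
    then have "(h ^^ (j - i)) b = b"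
      using least_power_dvd[OF h] eq by metis
    then show ?thesis using split by simp
  qed
  show ?thesis
  proof (cases "i \<le> j")
    case True
    then show ?thesis using *[of i j] ij by simp
  next
    case False
    then show ?thesis using *[of j i] ij by simp
  qed
qed

lemma commute_funpow:
  assumes "\<pi> \<circ> h = h \<circ> \<pi>" shows "\<pi> ((h ^^ i) x) = (h ^^ i) (\<pi> x)"
  using assms by (induction i) (auto simp: fun_eq_iff)

lemma least_power_commute:
  assumes "inj \<pi>" "\<pi> \<circ> h = h \<circ> \<pi>"
  shows "least_power h (\<pi> x) = least_power h x"
  unfolding least_power_def commute_funpow[OF assms(2), symmetric] inj_eq[OF assms(1)] ..

lemma funpow_in_invariant: "h ` S \<subseteq> S \<Longrightarrow> x \<in> S \<Longrightarrow> (h ^^ i) x \<in> S"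
  by (induction i) auto

text \<open>Permutations commuting with \<open>h\<close> act transitively on the points of a given period: within
  one cycle a power of \<open>h\<close>, cut off outside the cycle, does the job; two different cycles of
  the same length can be swapped pointwise.\<close>

lemma commutant_moving:
  assumes h: "permutation h" and S: "h ` S \<subseteq> S" "a \<in> S" "b \<in> S"
    and eq: "least_power h a = least_power h b"
  shows "\<exists>\<sigma>\<in>commutants h S. \<sigma> a = b"
proof -
  define cyc where "cyc x = range (\<lambda>i. (h ^^ i) x)" for x
  have cycS: "cyc x \<subseteq> S" if "x \<in> S" for x
    using funpow_in_invariant[OF S(1) that] by (auto simp: cyc_def)
  have self: "x \<in> cyc x" for x
    unfolding cyc_def by (metis funpow_0 rangeI)
  have inj: "inj h" using h permutation_bijective bij_is_inj by blast
  have dj: "cyc x = cyc y" if "z \<in> cyc x" "z \<in> cyc y" for x y z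
  proof -
    have "disjoint (range cyc)"
      using disjoint_support[OF h] unfolding support_set[OF h] cyc_def .
    then show ?thesis using that unfolding pairwise_def disjnt_def by (metis disjoint_iff rangeI)
  qed
  have inv: "h x \<in> cyc y \<longleftrightarrow> x \<in> cyc y" for x y
  proof -
    have "h x \<in> cyc x" using rangeI[of "\<lambda>i. (h ^^ i) x" 1] by (simp add: cyc_def)
    then show ?thesis using dj[of "h x" x y] dj[of x x y] self[of x] by blast
  qed
  show ?thesis
  proof (cases "b \<in> cyc a")
    case True
    then obtain i where i: "b = (h ^^ i) a" by (auto simp: cyc_def)
    define \<sigma> where "\<sigma> = perm_restrict (h ^^ i) (cyc a)"
    have fin: "finite (cyc a)"
      using support_set[OF h, of a] unfolding cyc_def by (metis List.finite_set)
    have sub: "(h ^^ i) ` cyc a \<subseteq> cyc a"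
    proof
      fix y assume "y \<in> (h ^^ i) ` cyc a"
      then obtain j where "y = (h ^^ (i + j)) a" by (auto simp: cyc_def funpow_add)
      then show "y \<in> cyc a" by (auto simp only: cyc_def)
    qed
    have "inj_on (h ^^ i) (cyc a)"
      using inj_fn[OF inj] by (rule inj_on_subset) simp
    then have "\<sigma> permutes cyc a"
      unfolding \<sigma>_def using sub fin by (rule perm_restrict_permutes)
    then have "\<sigma> permutes S" using cycS[OF S(2)] permutes_subset by blast
    moreover have "\<sigma> \<circ> h = h \<circ> \<sigma>"
      by (auto simp: \<sigma>_def perm_restrict_def fun_eq_iff inv funpow_swap1)
    moreover have "\<sigma> a = b" using self by (simp add: \<sigma>_def perm_restrict_def i)
    ultimately show ?thesis by (auto simp: commutants_def)
  next
    case False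
    \<comment> \<open>The choice of the exponent is immaterial, as the equations \<open>sa\<close> and \<open>sb\<close> show.\<close>
    define \<sigma> where "\<sigma> x = (if x \<in> cyc a then (h ^^ (SOME i. (h ^^ i) a = x)) b
        else if x \<in> cyc b then (h ^^ (SOME i. (h ^^ i) b = x)) a else x)" for x
    have nab: "(h ^^ i) b \<notin> cyc a" for i
      using False dj self unfolding cyc_def by (metis rangeI)
    have in_a: "(h ^^ i) a \<in> cyc a" and in_b: "(h ^^ i) b \<in> cyc b" for i
      by (auto simp: cyc_def)
    have sa: "\<sigma> ((h ^^ i) a) = (h ^^ i) b" for i
    proof -
      have "(h ^^ (SOME j. (h ^^ j) a = (h ^^ i) a)) a = (h ^^ i) a"
        by (rule someI) (rule refl)
      from funpow_eq_transfer[OF h eq this] show ?thesis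
        using in_a[of i] by (simp add: \<sigma>_def)
    qed
    have sb: "\<sigma> ((h ^^ i) b) = (h ^^ i) a" for i
    proof -
      have "(h ^^ (SOME j. (h ^^ j) b = (h ^^ i) b)) b = (h ^^ i) b"
        by (rule someI) (rule refl)
      from funpow_eq_transfer[OF h eq[symmetric] this] show ?thesis
        using in_b[of i] nab[of i] by (simp add: \<sigma>_def)
    qed
    have other: "\<sigma> x = x" if "x \<notin> cyc a" "x \<notin> cyc b" for x
      using that by (simp add: \<sigma>_def)
    have cases3: "(\<exists>i. x = (h ^^ i) a) \<or> (\<exists>i. x = (h ^^ i) b) \<or> (x \<notin> cyc a \<and> x \<notin> cyc b)" for x
      by (auto simp: cyc_def)
    have invol: "\<sigma> (\<sigma> x) = x" for x
      using cases3[of x] by (auto simp: sa sb other)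
    have outside: "\<sigma> x = x" if "x \<notin> S" for x
      using that cycS S other by blast
    have "\<sigma> permutes S"
      unfolding permutes_def
    proof (intro conjI allI impI ex1I)
      show "\<sigma> (\<sigma> y) = y" for y by (rule invol)
      show "x = \<sigma> y" if "\<sigma> x = y" for x y using invol[of x] that by simp
    qed (use outside in blast)
    moreover have "\<sigma> (h x) = h (\<sigma> x)" for x
      using cases3[of x]
    proof (elim disjE exE)
      fix i assume "x = (h ^^ i) a"
      then show ?thesis using sa[of i] sa[of "Suc i"] by simp
    next
      fix i assume "x = (h ^^ i) b"
      then show ?thesis using sb[of i] sb[of "Suc i"] by simp
    next
      assume "x \<notin> cyc a \<and> x \<notin> cyc b"
      then show ?thesis by (simp add: other inv)
    qed
    moreover have "\<sigma> a = b" using sa[of 0] by simp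
    ultimately show ?thesis by (auto simp: commutants_def fun_eq_iff)
  qed
qed

lemma finite_commutants: "finite S \<Longrightarrow> finite (commutants h S)"
  unfolding commutants_def by (rule finite_subset[OF _ finite_permutations]) auto

lemma commutants_comp:
  "\<sigma> \<in> commutants h S \<Longrightarrow> \<pi> \<in> commutants h S \<Longrightarrow> \<sigma> \<circ> \<pi> \<in> commutants h S"
  unfolding commutants_def using permutes_compose
  by (auto simp: fun_eq_iff)

lemma commutants_inv:
  assumes "\<sigma> \<in> commutants h S" shows "perm_inv \<sigma> \<in> commutants h S"
proof -
  have p: "\<sigma> permutes S" and c: "\<And>x. \<sigma> (h x) = h (\<sigma> x)"
    using assms by (auto simp: commutants_def fun_eq_iff)
  have "perm_inv \<sigma> (h x) = h (perm_inv \<sigma> x)" for x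
    using c[of "perm_inv \<sigma> x"] permutes_inverses[OF p] by metis
  then show ?thesis using permutes_inv[OF p] by (auto simp: commutants_def fun_eq_iff)
qed

text \<open>Orbit counting for the centralizer acting on \<open>S\<close>: the orbit of \<open>a\<close> consists of the points
  with the same period, and a commuting permutation that fixes \<open>a\<close> fixes its whole cycle, so the
  stabilizer is the centralizer on the complement of the cycle.\<close>

lemma card_commutants_step:
  assumes h: "permutation h" and S: "h ` S \<subseteq> S" "a \<in> S" "finite S"
  shows "card (commutants h S) =
    card {x \<in> S. least_power h x = least_power h a} * card (commutants h (S - set (support h a)))"
proof -
  let ?C = "commutants h S" and ?T = "{x \<in> S. least_power h x = least_power h a}"
  have maps: "(\<lambda>\<pi>. \<pi> a) ` ?C \<subseteq> ?T"
  proof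
    fix y assume "y \<in> (\<lambda>\<pi>. \<pi> a) ` ?C"
    then obtain \<pi> where \<pi>: "\<pi> permutes S" "\<pi> \<circ> h = h \<circ> \<pi>" "y = \<pi> a"
      by (auto simp: commutants_def)
    have "y \<in> S" using permutes_in_image[OF \<pi>(1)] S(2) \<pi>(3) by simp
    moreover have "least_power h y = least_power h a"
      using least_power_commute[OF permutes_inj[OF \<pi>(1)] \<pi>(2)] \<pi>(3) by simp
    ultimately show "y \<in> ?T" by simp
  qed
  have fibre: "card {\<pi> \<in> ?C. \<pi> a = b} = card {\<pi> \<in> ?C. \<pi> a = a}" if b: "b \<in> ?T" for b
  proof -
    obtain \<sigma> where \<sigma>: "\<sigma> \<in> ?C" "\<sigma> a = b"
      using commutant_moving[OF h S(1,2), of b] b by auto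
    have p: "\<sigma> permutes S" using \<sigma> by (auto simp: commutants_def)
    \<comment> \<open>All fibres of the evaluation at \<open>a\<close> are translates of the stabilizer.\<close>
    have "bij_betw (\<lambda>\<pi>. \<sigma> \<circ> \<pi>) {\<pi> \<in> ?C. \<pi> a = a} {\<pi> \<in> ?C. \<pi> a = b}"
    proof (rule bij_betw_byWitness[where f' = "\<lambda>\<pi>. perm_inv \<sigma> \<circ> \<pi>"])
      show "\<forall>\<pi>\<in>{\<pi> \<in> ?C. \<pi> a = a}. perm_inv \<sigma> \<circ> (\<sigma> \<circ> \<pi>) = \<pi>"
        using permutes_inverses[OF p] by (auto simp: fun_eq_iff)
      show "\<forall>\<pi>\<in>{\<pi> \<in> ?C. \<pi> a = b}. \<sigma> \<circ> (perm_inv \<sigma> \<circ> \<pi>) = \<pi>"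
        using permutes_inverses[OF p] by (auto simp: fun_eq_iff)
      show "(\<lambda>\<pi>. \<sigma> \<circ> \<pi>) ` {\<pi> \<in> ?C. \<pi> a = a} \<subseteq> {\<pi> \<in> ?C. \<pi> a = b}"
        using commutants_comp[OF \<sigma>(1)] \<sigma>(2) by auto
      show "(\<lambda>\<pi>. perm_inv \<sigma> \<circ> \<pi>) ` {\<pi> \<in> ?C. \<pi> a = b} \<subseteq> {\<pi> \<in> ?C. \<pi> a = a}"
        using commutants_comp[OF commutants_inv[OF \<sigma>(1)]] \<sigma>(2) permutes_inverses[OF p] by auto
    qed
    then show ?thesis by (simp add: bij_betw_same_card)
  qed
  have stab: "{\<pi> \<in> ?C. \<pi> a = a} = commutants h (S - set (support h a))"
  proof (intro equalityI subsetI)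
    fix \<pi> assume "\<pi> \<in> {\<pi> \<in> ?C. \<pi> a = a}"
    then have p: "\<pi> permutes S" and c: "\<pi> \<circ> h = h \<circ> \<pi>" and a: "\<pi> a = a"
      by (auto simp: commutants_def)
    have "\<pi> x = x" if "x \<in> set (support h a)" for x
      using that commute_funpow[OF c, of _ a] a by auto
    then have "\<pi> permutes (S - set (support h a))"
      using permutes_superset[OF p] by blast
    with c show "\<pi> \<in> commutants h (S - set (support h a))" by (simp add: commutants_def)
  next
    fix \<pi> assume "\<pi> \<in> commutants h (S - set (support h a))"
    then have p: "\<pi> permutes (S - set (support h a))" and c: "\<pi> \<circ> h = h \<circ> \<pi>"
      by (auto simp: commutants_def)
    have "a \<in> set (support h a)"
      unfolding support_set[OF h] by (metis funpow_0 rangeI)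
    then have "\<pi> a = a" using permutes_not_in[OF p] by blast
    with p c show "\<pi> \<in> {\<pi> \<in> ?C. \<pi> a = a}"
      by (auto simp: commutants_def intro: permutes_subset)
  qed
  have "card ?C = (\<Sum>b\<in>?T. card {\<pi> \<in> ?C. \<pi> a = b})"
    using sum.group[OF finite_commutants[OF S(3)] _ maps, of "\<lambda>_. 1 :: nat"] S(3) by simp
  also have "\<dots> = card ?T * card {\<pi> \<in> ?C. \<pi> a = a}"
    using fibre by simp
  finally show ?thesis by (simp add: stab)
qed

text \<open>The classical order of a centralizer in a symmetric group, by removing one cycle at a time:
  if there are \<open>c + 1\<close> cycles of length \<open>k\<close>, the removal contributes the factor \<open>k * (c + 1)\<close>.
  A period that does not occur in \<open>S\<close> contributes the factor 1, so \<open>K\<close> may be kept fixed in the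
  induction.\<close>

theorem card_commutants:
  assumes h: "permutation h" and "h ` S \<subseteq> S" "finite S" "finite K" "least_power h ` S \<subseteq> K"
  shows "card (commutants h S) = (\<Prod>k\<in>K. k ^ cycle_count h S k * fact (cycle_count h S k))"
proof -
  let ?N = "\<lambda>S k. card {x \<in> S. least_power h x = k}"
  have "(\<forall>k. k dvd ?N S k) \<and>
      card (commutants h S) = (\<Prod>k\<in>K. k ^ cycle_count h S k * fact (cycle_count h S k))"
    using assms(3,2,5)
  proof (induction S rule: finite_psubset_induct)
    case (psubset S)
    show ?case
    proof (cases "S = {}")
      case True
      have "commutants h {} = {id}" by (auto simp: commutants_def)
      with True show ?thesis by (simp add: cycle_count_def)
    next
      case False
      then obtain a where a: "a \<in> S" by blast
      define B where "B = set (support h a)"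
      define k where "k = least_power h a"
      let ?S = "S - B"
      have B: "B = range (\<lambda>i. (h ^^ i) a)"
        unfolding B_def by (rule support_set[OF h])
      have k0: "k > 0" unfolding k_def by (rule least_power_of_permutation[OF h])
      have cardB: "card B = k"
        using distinct_card[OF cycle_of_permutation[OF h, of a]] by (simp add: B_def k_def)
      have BS: "B \<subseteq> S"
        using funpow_in_invariant[OF psubset.prems(1) a] by (auto simp: B)
      have aB: "a \<in> B" unfolding B by (metis funpow_0 rangeI)
      have lpB: "least_power h x = k" if xB: "x \<in> B" for x
      proof -
        obtain i where "x = (h ^^ i) a" using xB unfolding B by blast
        moreover have "inj (h ^^ i)"
          using h permutation_bijective bij_is_inj inj_fn by blast
        moreover have "(h ^^ i) \<circ> h = h \<circ> (h ^^ i)"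
          by (auto simp: fun_eq_iff funpow_swap1)
        ultimately show ?thesis using least_power_commute[of "h ^^ i" h a] by (simp add: k_def)
      qed
      have "h x \<notin> B" if "x \<notin> B" for x
      proof
        assume "h x \<in> B"
        moreover have "h x \<in> set (support h x)" "x \<in> set (support h x)"
          using rangeI[of "\<lambda>i. (h ^^ i) x" 1] rangeI[of "\<lambda>i. (h ^^ i) x" 0]
          unfolding support_set[OF h] by simp_all
        ultimately show False
          using disjoint_support'[OF h, of x a] that unfolding B_def by blast
      qed
      then have inv: "h ` ?S \<subseteq> ?S" using psubset.prems(1) by auto
      have IH: "j dvd ?N ?S j"
          "card (commutants h ?S) = (\<Prod>k\<in>K. k ^ cycle_count h ?S k * fact (cycle_count h ?S k))" for j
        using psubset.IH[of ?S] inv psubset.prems(2) a aB by auto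
      have Nk: "?N S k = k + ?N ?S k"
      proof -
        have "{x \<in> S. least_power h x = k} = B \<union> {x \<in> ?S. least_power h x = k}"
          using BS lpB by auto
        then show ?thesis
          using cardB psubset.hyps finite_subset[OF BS]
          by (simp add: card_Un_disjoint disjoint_iff)
      qed
      have Nj: "?N S j = ?N ?S j" if "j \<noteq> k" for j
        using lpB that by (intro arg_cong[where f = card]) auto
      have dvd: "j dvd ?N S j" for j
        using IH(1)[of j] Nk Nj by (cases "j = k") auto
      define c where "c = cycle_count h ?S k"
      have ck: "cycle_count h S k = Suc c"
        unfolding cycle_count_def c_def Nk using k0 by (simp add: div_add_self1)
      have cj: "cycle_count h S j = cycle_count h ?S j" if "j \<noteq> k" for j
        using Nj[OF that] by (simp add: cycle_count_def)
      have NSk: "?N S k = k * Suc c"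
        using dvd[of k] ck unfolding cycle_count_def by (metis dvd_mult_div_cancel)
      have kK: "k \<in> K" using psubset.prems(2) a by (auto simp: k_def)
      have "card (commutants h S) = k * Suc c * card (commutants h ?S)"
        using card_commutants_step[OF h psubset.prems(1) a psubset.hyps(1)] NSk
        by (simp add: k_def B_def)
      also have "\<dots> = k * Suc c * (k ^ c * fact c *
          (\<Prod>j\<in>K-{k}. j ^ cycle_count h ?S j * fact (cycle_count h ?S j)))"
        by (simp add: IH(2) prod.remove[OF assms(4) kK] c_def)
      also have "\<dots> = k ^ Suc c * fact (Suc c) *
          (\<Prod>j\<in>K-{k}. j ^ cycle_count h S j * fact (cycle_count h S j))"
        using cj by (simp add: algebra_simps)
      also have "\<dots> = (\<Prod>j\<in>K. j ^ cycle_count h S j * fact (cycle_count h S j))"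
        by (simp add: prod.remove[OF assms(4) kK] ck)
      finally show ?thesis using dvd by blast
    qed
  qed
  then show ?thesis ..
qed

section \<open>The word congruence and its short classes\<close>

abbreviation grid :: "nat \<Rightarrow> nat \<Rightarrow> (nat \<times> nat) set" where
  "grid n m \<equiv> {1..n} \<times> {1..m}"

definition gens :: "nat \<Rightarrow> nat \<Rightarrow> gen set" where
  "gens n m = Gen_e ` {1..n} \<union> Gen_f ` {1..m}"

abbreviation word_class :: "nat \<Rightarrow> nat \<Rightarrow> (nat \<times> nat \<Rightarrow> nat \<times> nat) \<Rightarrow> gen list \<Rightarrow> gen list set" where
  "word_class n m \<theta> w \<equiv> word_cong n m \<theta> `` {w}"

lemma words_gens: "w \<in> words n m \<longleftrightarrow> set w \<subseteq> gens n m"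
  by (auto simp: words_def gens_def)

lemma word_cong_words: "(w, w') \<in> word_cong n m \<theta> \<Longrightarrow> w \<in> words n m \<and> w' \<in> words n m"
  by (simp add: word_cong_def)

lemma equiv_word_cong: "equiv (words n m) (word_cong n m \<theta>)"
proof (rule equivI)
  show "word_cong n m \<theta> \<subseteq> words n m \<times> words n m"
    by (auto simp: word_cong_def)
  show "refl_on (words n m) (word_cong n m \<theta>)"
    by (auto simp: refl_on_def word_cong_def)
  show "sym (word_cong n m \<theta>)"
    by (auto simp: sym_def word_cong_def intro: equivclp_sym)
  show "trans (word_cong n m \<theta>)"
    unfolding trans_def word_cong_def by (auto intro: equivclp_trans)
qed

lemma word_class_eq_iff:
  "w \<in> words n m \<Longrightarrow> w' \<in> words n m \<Longrightarrow>
    word_class n m \<theta> w = word_class n m \<theta> w' \<longleftrightarrow> (w, w') \<in> word_cong n m \<theta>"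
  using eq_equiv_class_iff[OF equiv_word_cong] by blast

lemma commutation_step_context:
  assumes "commutation_step n m \<theta> w w'" "x \<in> words n m" "y \<in> words n m"
  shows "commutation_step n m \<theta> (x @ w @ y) (x @ w' @ y)"
  using assms(1)
proof cases
  case (1 u v i j i' j')
  have "commutation_step n m \<theta> ((x @ u) @ [Gen_e i, Gen_f j] @ (v @ y))
      ((x @ u) @ [Gen_f j', Gen_e i'] @ (v @ y))"
    using 1 assms(2,3) by (intro commutation_step.intros) (auto simp: words_gens)
  then show ?thesis by (simp add: 1)
qed

lemma equivclp_map:
  assumes "\<And>x y. r x y \<Longrightarrow> equivclp s (f x) (f y)" "equivclp r x y"
  shows "equivclp s (f x) (f y)"
  using assms(2)
proof (induction rule: equivclp_induct)
  case base
  show ?case by simp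
next
  case (step y z)
  then show ?case using assms(1) by (meson equivclp_sym equivclp_trans)
qed

lemma word_cong_context:
  assumes "(w, w') \<in> word_cong n m \<theta>" "x \<in> words n m" "y \<in> words n m"
  shows "(x @ w @ y, x @ w' @ y) \<in> word_cong n m \<theta>"
  using assms equivclp_map[of "commutation_step n m \<theta>" "commutation_step n m \<theta>" "\<lambda>w. x @ w @ y" w w']
    commutation_step_context[of n m \<theta> _ _ x y]
  by (auto simp: word_cong_def words_gens r_into_equivclp)

lemma word_cong_append:
  assumes "(x, x') \<in> word_cong n m \<theta>" "(y, y') \<in> word_cong n m \<theta>"
  shows "(x @ y, x' @ y') \<in> word_cong n m \<theta>"
proof -
  have "(x @ y, x' @ y) \<in> word_cong n m \<theta>"
    using word_cong_context[OF assms(1), of "[]" y] word_cong_words[OF assms(2)]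
    by (simp add: words_gens)
  moreover have "(x' @ y, x' @ y') \<in> word_cong n m \<theta>"
    using word_cong_context[OF assms(2), of x' "[]"] word_cong_words[OF assms(1)]
    by (simp add: words_gens)
  ultimately show ?thesis
    using equiv_word_cong[of n m \<theta>] by (meson equivE transE)
qed

lemma theta_semigroup_carrier:
  "carrier (theta_semigroup n m \<theta>) = word_class n m \<theta> ` words n m"
  by (auto simp: theta_semigroup_def quotient_def)

lemma theta_semigroup_one: "\<one>\<^bsub>theta_semigroup n m \<theta>\<^esub> = word_class n m \<theta> []"
  by (simp add: theta_semigroup_def)

lemma theta_semigroup_mult:
  assumes "x \<in> words n m" "y \<in> words n m"
  shows "word_class n m \<theta> x \<otimes>\<^bsub>theta_semigroup n m \<theta>\<^esub> word_class n m \<theta> y = word_class n m \<theta> (x @ y)"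
proof -
  have eq: "word_class n m \<theta> (x' @ y') = word_class n m \<theta> (x @ y)"
    if "x' \<in> word_class n m \<theta> x" "y' \<in> word_class n m \<theta> y" for x' y'
  proof -
    have "(x @ y, x' @ y') \<in> word_cong n m \<theta>" using that word_cong_append by blast
    then show ?thesis using equiv_class_eq[OF equiv_word_cong] by metis
  qed
  have x: "x \<in> word_class n m \<theta> x" and y: "y \<in> word_class n m \<theta> y"
    using equiv_class_self[OF equiv_word_cong assms(1)] equiv_class_self[OF equiv_word_cong assms(2)] .
  have "(\<Union>x'\<in>word_class n m \<theta> x. \<Union>y'\<in>word_class n m \<theta> y. word_class n m \<theta> (x' @ y'))
      = (\<Union>x'\<in>word_class n m \<theta> x. \<Union>y'\<in>word_class n m \<theta> y. word_class n m \<theta> (x @ y))"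
    by (rule SUP_cong[OF refl], rule SUP_cong[OF refl], rule eq)
  also have "\<dots> = word_class n m \<theta> (x @ y)"
    using x y by blast
  finally show ?thesis by (simp only: theta_semigroup_def monoid.simps)
qed

text \<open>A relation only moves an \<open>e\<close> past an \<open>f\<close> and changes indices, so both letter counts are
  invariant.\<close>

lemma word_cong_degree:
  assumes "(w, w') \<in> word_cong n m \<theta>"
  shows "word_degree w = word_degree w'"
proof -
  have step: "word_degree x = word_degree y" if "commutation_step n m \<theta> x y" for x y
    using that by cases (simp add: word_degree_def)
  have "equivclp (commutation_step n m \<theta>) w w'" using assms by (simp add: word_cong_def)
  then show ?thesis
  proof (induction rule: equivclp_induct)
    case (step y z)
    then show ?case using \<open>\<And>x y. commutation_step n m \<theta> x y \<Longrightarrow> word_degree x = word_degree y\<close> by metis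
  qed simp
qed

lemma word_cong_length:
  assumes "(w, w') \<in> word_cong n m \<theta>" shows "length w = length w'"
proof -
  have "length v = fst (word_degree v) + snd (word_degree v)" for v
    using sum_length_filter_compl[of is_gen_e v] by (simp add: word_degree_def)
  then show ?thesis using word_cong_degree[OF assms] by metis
qed

lemma commutation_step_pair:
  "commutation_step n m \<theta> [a, b] w \<longleftrightarrow>
    (\<exists>i\<in>{1..n}. \<exists>j\<in>{1..m}. a = Gen_e i \<and> b = Gen_f j \<and>
      w = [Gen_f (snd (\<theta> (i, j))), Gen_e (fst (\<theta> (i, j)))])"
  (is "?L \<longleftrightarrow> ?R")
proof
  assume ?L
  then show ?R
  proof cases
    case (1 u v i j i' j')
    then have "u = [] \<and> v = []"
      by (cases u; cases "tl u"; cases v) auto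
    with 1 show ?thesis by auto
  qed
next
  assume ?R
  then show ?L
    using commutation_step.intros[of "[]" n m "[]" _ _ \<theta>] by (fastforce simp: words_gens)
qed

lemma equivclp_short:
  assumes "equivclp (commutation_step n m \<theta>) w w'" "length w \<le> 1"
  shows "w' = w"
  using assms(1)
proof (induction rule: equivclp_induct)
  case (step y z)
  then show ?case using assms(2) by (auto elim!: commutation_step.cases)
qed simp

lemma word_class_short:
  "w \<in> words n m \<Longrightarrow> length w \<le> 1 \<Longrightarrow> word_class n m \<theta> w = {w}"
  using equivclp_short by (fastforce simp: word_cong_def)

lemma commutation_step_length: "commutation_step n m \<theta> w w' \<Longrightarrow> length w = length w'"
  by (auto elim!: commutation_step.cases)

text \<open>A word of two letters admits at most one relation, as it is either an \<open>ef\<close>-word or an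
  \<open>fe\<close>-word; as \<open>\<theta>\<close> is injective, different \<open>ef\<close>-words lead to different
  \<open>fe\<close>-words. So chains of relations collapse to a single step.\<close>

lemma equivclp_pair:
  assumes "inj_on \<theta> (grid n m)" "equivclp (commutation_step n m \<theta>) [a, b] w"
  shows "w = [a, b] \<or> commutation_step n m \<theta> [a, b] w \<or> commutation_step n m \<theta> w [a, b]"
  using assms(2)
proof (induction rule: equivclp_induct)
  case base
  show ?case by simp
next
  case (step y z)
  have len: "length y = 2"
    using step.IH commutation_step_length by fastforce
  then obtain c d where y: "y = [c, d]" by (auto simp: length_Suc_conv numeral_2_eq_2)
  have "length z = 2" using step.hyps(2) len commutation_step_length by fastforce
  then obtain c' d' where z: "z = [c', d']" by (auto simp: length_Suc_conv numeral_2_eq_2)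
  have "(i, j) = (i', j')" if "i \<in> {1..n}" "j \<in> {1..m}" "i' \<in> {1..n}" "j' \<in> {1..m}"
      "fst (\<theta> (i, j)) = fst (\<theta> (i', j'))" "snd (\<theta> (i, j)) = snd (\<theta> (i', j'))" for i j i' j'
    by (rule inj_onD[OF assms(1)]) (use that in \<open>auto simp: prod_eq_iff\<close>)
  then show ?case
    using step.IH step.hyps(2) unfolding y z commutation_step_pair by auto
qed

lemma word_cong_pair:
  assumes "inj_on \<theta> (grid n m)" "([a, b], [c, d]) \<in> word_cong n m \<theta>"
  shows "[c, d] = [a, b] \<or> commutation_step n m \<theta> [a, b] [c, d] \<or> commutation_step n m \<theta> [c, d] [a, b]"
  using equivclp_pair[OF assms(1), of a b "[c, d]"] assms(2) by (auto simp: word_cong_def)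

text \<open>In a monoid whose only unit is the identity, such as the semigroup of a 2-graph, these are the
  irreducible elements.\<close>

definition indecomposable :: "('a, 'b) monoid_scheme \<Rightarrow> 'a \<Rightarrow> bool" where
  "indecomposable M x \<longleftrightarrow> x \<in> carrier M \<and> x \<noteq> \<one>\<^bsub>M\<^esub> \<and>
    (\<forall>y\<in>carrier M. \<forall>z\<in>carrier M. x = y \<otimes>\<^bsub>M\<^esub> z \<longrightarrow> y = \<one>\<^bsub>M\<^esub> \<or> z = \<one>\<^bsub>M\<^esub>)"

lemma word_class_length_eq:
  assumes "word_class n m \<theta> w = word_class n m \<theta> w'" "w \<in> words n m" "w' \<in> words n m"
  shows "length w = length w'"
  using assms word_class_eq_iff[of w n m w' \<theta>] word_cong_length by blast

text \<open>The generators are thus determined by the bare semigroup, without the degree map.\<close>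

lemma indecomposable_iff:
  "indecomposable (theta_semigroup n m \<theta>) X \<longleftrightarrow> (\<exists>a\<in>gens n m. X = {[a]})"
  (is "?L \<longleftrightarrow> ?R")
proof
  assume L: ?L
  then obtain w where w: "w \<in> words n m" "X = word_class n m \<theta> w"
    by (auto simp: indecomposable_def theta_semigroup_carrier)
  show ?R
  proof (cases w)
    case Nil
    then show ?thesis using L w by (simp add: indecomposable_def theta_semigroup_one)
  next
    case (Cons a v)
    have av: "[a] \<in> words n m" "v \<in> words n m" "[] \<in> words n m"
      using w(1) Cons by (auto simp: words_gens)
    have X: "X = word_class n m \<theta> [a] \<otimes>\<^bsub>theta_semigroup n m \<theta>\<^esub> word_class n m \<theta> v"
      using theta_semigroup_mult[OF av(1,2)] w(2) Cons by simp
    have "word_class n m \<theta> [a] \<noteq> word_class n m \<theta> []"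
      using word_class_length_eq[OF _ av(1,3)] by fastforce
    then have "word_class n m \<theta> v = word_class n m \<theta> []"
      using L X av by (auto simp: indecomposable_def theta_semigroup_carrier theta_semigroup_one)
    then have "v = []" using word_class_length_eq[OF _ av(2,3)] by fastforce
    then show ?thesis using w Cons word_class_short[of w n m \<theta>] by (auto simp: words_gens)
  qed
next
  assume ?R
  then obtain a where a: "a \<in> gens n m" "X = {[a]}" by blast
  have W: "[a] \<in> words n m" "[] \<in> words n m" using a by (auto simp: words_gens)
  have X: "X = word_class n m \<theta> [a]" using word_class_short[OF W(1)] a by simp
  have "word_class n m \<theta> [a] \<noteq> word_class n m \<theta> []"
    using word_class_length_eq[OF _ W] by fastforce
  moreover have "y = [] \<or> z = []"
    if "word_class n m \<theta> [a] = word_class n m \<theta> (y @ z)" "y \<in> words n m" "z \<in> words n m" for y z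
  proof -
    have "length [a] = length (y @ z)"
      using word_class_length_eq[OF that(1) W(1)] that by (auto simp: words_gens)
    then show ?thesis by (cases y; cases z) auto
  qed
  ultimately show ?L
    using W by (auto simp: indecomposable_def X theta_semigroup_carrier theta_semigroup_one theta_semigroup_mult)
qed

text \<open>Isomorphisms are merely required to be multiplicative and bijective, so preservation of the
  identity has to be deduced from surjectivity.\<close>

lemma iso_one:
  assumes M: "Group.monoid M" and N: "Group.monoid N" and h: "h \<in> iso M N"
  shows "h \<one>\<^bsub>M\<^esub> = \<one>\<^bsub>N\<^esub>"
proof -
  interpret M: Group.monoid M by fact
  interpret N: Group.monoid N by fact
  have hom: "h \<in> hom M N" and bij: "bij_betw h (carrier M) (carrier N)"
    using h by (auto simp: iso_def)
  obtain x where x: "x \<in> carrier M" "h x = \<one>\<^bsub>N\<^esub>"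
    using bij N.one_closed unfolding bij_betw_def by (metis imageE)
  have "h x = h \<one>\<^bsub>M\<^esub> \<otimes>\<^bsub>N\<^esub> h x"
    using hom_mult[OF hom M.one_closed x(1)] x by simp
  then show ?thesis using x hom_in_carrier[OF hom M.one_closed] by simp
qed

lemma iso_indecomposable:
  assumes M: "Group.monoid M" and N: "Group.monoid N" and h: "h \<in> iso M N" and x: "x \<in> carrier M"
  shows "indecomposable N (h x) \<longleftrightarrow> indecomposable M x"
proof -
  interpret M: Group.monoid M by fact
  have hom: "h \<in> hom M N" and inj: "inj_on h (carrier M)" and im: "h ` carrier M = carrier N"
    using h by (auto simp: iso_def bij_betw_def)
  have inj_iff: "h y = h z \<longleftrightarrow> y = z" if "y \<in> carrier M" "z \<in> carrier M" for y z
    using inj that by (auto dest: inj_onD)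
  show ?thesis
    unfolding indecomposable_def im[symmetric] ball_simps iso_one[OF M N h, symmetric]
    using x by (auto simp: inj_iff hom_mult[OF hom, symmetric])
qed

lemma theta_semigroup_monoid: "Group.monoid (theta_semigroup n m \<theta>)"
proof (rule monoidI)
  have app: "x @ y \<in> words n m" if "x \<in> words n m" "y \<in> words n m" for x y
    using that by (auto simp: words_gens)
  have nil: "[] \<in> words n m" by (simp add: words_gens)
  let ?G = "theta_semigroup n m \<theta>"
  show "\<one>\<^bsub>?G\<^esub> \<in> carrier ?G" using nil by (auto simp: theta_semigroup_carrier theta_semigroup_one)
  fix X Y Z assume "X \<in> carrier ?G"
  then obtain x where x: "x \<in> words n m" "X = word_class n m \<theta> x" by (auto simp: theta_semigroup_carrier)
  show "\<one>\<^bsub>?G\<^esub> \<otimes>\<^bsub>?G\<^esub> X = X" "X \<otimes>\<^bsub>?G\<^esub> \<one>\<^bsub>?G\<^esub> = X"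
    using theta_semigroup_mult[OF nil x(1)] theta_semigroup_mult[OF x(1) nil] x(2)
    by (simp_all add: theta_semigroup_one)
  assume "Y \<in> carrier ?G"
  then obtain y where y: "y \<in> words n m" "Y = word_class n m \<theta> y" by (auto simp: theta_semigroup_carrier)
  show "X \<otimes>\<^bsub>?G\<^esub> Y \<in> carrier ?G"
    using x y app by (auto simp: theta_semigroup_mult theta_semigroup_carrier)
  assume "Z \<in> carrier ?G"
  then obtain z where z: "z \<in> words n m" "Z = word_class n m \<theta> z" by (auto simp: theta_semigroup_carrier)
  show "X \<otimes>\<^bsub>?G\<^esub> Y \<otimes>\<^bsub>?G\<^esub> Z = X \<otimes>\<^bsub>?G\<^esub> (Y \<otimes>\<^bsub>?G\<^esub> Z)"
    using x y z app by (simp add: theta_semigroup_mult)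
qed

section \<open>Isomorphisms as changes of generators\<close>

lemma map_word_cong:
  assumes g: "g ` gens n m \<subseteq> gens n m"
    and rel: "\<And>i j. (i, j) \<in> grid n m \<Longrightarrow>
      (map g [Gen_e i, Gen_f j], map g [Gen_f (snd (\<theta> (i, j))), Gen_e (fst (\<theta> (i, j)))])
        \<in> word_cong n m \<theta>'"
    and w: "(w, w') \<in> word_cong n m \<theta>"
  shows "(map g w, map g w') \<in> word_cong n m \<theta>'"
proof -
  have gw: "map g x \<in> words n m" if "x \<in> words n m" for x
    using that g by (auto simp: words_gens)
  have "equivclp (commutation_step n m \<theta>') (map g x) (map g y)"
    if "commutation_step n m \<theta> x y" for x y
    using that
  proof cases
    case (1 u v i j i' j')
    show ?thesis
      using word_cong_context[OF rel[of i j], of "map g u" "map g v"] 1 gw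
      by (simp add: word_cong_def)
  qed
  then show ?thesis
    using w gw equivclp_map[of "commutation_step n m \<theta>" "commutation_step n m \<theta>'" "map g" w w']
    by (simp add: word_cong_def)
qed

text \<open>Applied letter by letter, a map of generators that respects the relations sends congruent words
  to congruent words. The inverse map makes the image of a class a full class rather than a
  subset of one, so that taking images is the isomorphism.\<close>

lemma theta_semigroup_isoI:
  assumes g: "g ` gens n m \<subseteq> gens n m" and g': "g' ` gens n m \<subseteq> gens n m"
    and inv: "\<And>a. a \<in> gens n m \<Longrightarrow> g' (g a) = a" "\<And>a. a \<in> gens n m \<Longrightarrow> g (g' a) = a"
    and rel: "\<And>i j. (i, j) \<in> grid n m \<Longrightarrow>
      (map g [Gen_e i, Gen_f j], map g [Gen_f (snd (\<theta> (i, j))), Gen_e (fst (\<theta> (i, j)))])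
        \<in> word_cong n m \<theta>'"
    and rel': "\<And>i j. (i, j) \<in> grid n m \<Longrightarrow>
      (map g' [Gen_e i, Gen_f j], map g' [Gen_f (snd (\<theta>' (i, j))), Gen_e (fst (\<theta>' (i, j)))])
        \<in> word_cong n m \<theta>"
  shows "theta_semigroup n m \<theta> \<cong> theta_semigroup n m \<theta>'"
proof -
  have fwd: "(map g w, map g w') \<in> word_cong n m \<theta>'" if "(w, w') \<in> word_cong n m \<theta>" for w w'
    by (rule map_word_cong[OF g _ that]) (rule rel)
  have bwd: "(map g' w, map g' w') \<in> word_cong n m \<theta>" if "(w, w') \<in> word_cong n m \<theta>'" for w w'
    by (rule map_word_cong[OF g' _ that]) (rule rel')
  have gw: "map g w \<in> words n m" "map g' w \<in> words n m"
    "map g' (map g w) = w" "map g (map g' w) = w" if "w \<in> words n m" for w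
  proof -
    have "set w \<subseteq> gens n m" using that by (simp add: words_gens)
    then show "map g w \<in> words n m" "map g' w \<in> words n m"
      "map g' (map g w) = w" "map g (map g' w) = w"
      using g g' inv by (induction w) (auto simp: words_gens)
  qed
  have image: "map g ` word_class n m \<theta> w = word_class n m \<theta>' (map g w)" if w: "w \<in> words n m" for w
  proof
    show "map g ` word_class n m \<theta> w \<subseteq> word_class n m \<theta>' (map g w)"
      using fwd by blast
    show "word_class n m \<theta>' (map g w) \<subseteq> map g ` word_class n m \<theta> w"
    proof
      fix v assume "v \<in> word_class n m \<theta>' (map g w)"
      then have v: "(map g w, v) \<in> word_cong n m \<theta>'" by simp
      then have "(w, map g' v) \<in> word_cong n m \<theta>"
        using bwd[OF v] gw(3)[OF w] by metis
      moreover have "v = map g (map g' v)"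
        using gw(4)[of v] word_cong_words[OF v] by simp
      ultimately show "v \<in> map g ` word_class n m \<theta> w" by blast
    qed
  qed
  have image': "map g' ` word_class n m \<theta>' w = word_class n m \<theta> (map g' w)" if w: "w \<in> words n m" for w
  proof -
    have "map g' ` word_class n m \<theta>' w = map g' ` map g ` word_class n m \<theta> (map g' w)"
      using image[of "map g' w"] gw w by simp
    also have "\<dots> = (\<lambda>x. x) ` word_class n m \<theta> (map g' w)"
      unfolding image_image using gw(3) word_cong_words by (intro image_cong refl) blast
    finally show ?thesis by simp
  qed
  have "(\<lambda>X. map g ` X) \<in> hom (theta_semigroup n m \<theta>) (theta_semigroup n m \<theta>')"
  proof (rule homI)
    fix X assume "X \<in> carrier (theta_semigroup n m \<theta>)"
    then obtain x where x: "x \<in> words n m" "X = word_class n m \<theta> x"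
      by (auto simp: theta_semigroup_carrier)
    show "map g ` X \<in> carrier (theta_semigroup n m \<theta>')"
      using x gw by (auto simp: theta_semigroup_carrier image)
    fix Y assume "Y \<in> carrier (theta_semigroup n m \<theta>)"
    then obtain y where y: "y \<in> words n m" "Y = word_class n m \<theta> y"
      by (auto simp: theta_semigroup_carrier)
    have xy: "x @ y \<in> words n m" using x y by (auto simp: words_gens)
    show "map g ` (X \<otimes>\<^bsub>theta_semigroup n m \<theta>\<^esub> Y) = map g ` X \<otimes>\<^bsub>theta_semigroup n m \<theta>'\<^esub> map g ` Y"
      using x y xy gw by (simp add: theta_semigroup_mult image)
  qed
  moreover have "bij_betw (\<lambda>X. map g ` X) (carrier (theta_semigroup n m \<theta>)) (carrier (theta_semigroup n m \<theta>'))"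
    by (rule bij_betw_byWitness[where f' = "\<lambda>X. map g' ` X"])
      (auto simp: theta_semigroup_carrier image image' gw simp del: map_map)
  ultimately show ?thesis unfolding is_iso_def iso_def by blast
qed

fun relabel :: "(nat \<Rightarrow> nat) \<Rightarrow> (nat \<Rightarrow> nat) \<Rightarrow> gen \<Rightarrow> gen" where
  "relabel \<alpha> \<beta> (Gen_e i) = Gen_e (\<alpha> i)"
| "relabel \<alpha> \<beta> (Gen_f j) = Gen_f (\<beta> j)"

fun exchange :: "(nat \<Rightarrow> nat) \<Rightarrow> (nat \<Rightarrow> nat) \<Rightarrow> gen \<Rightarrow> gen" where
  "exchange \<alpha> \<beta> (Gen_e i) = Gen_f (\<alpha> i)"
| "exchange \<alpha> \<beta> (Gen_f j) = Gen_e (\<beta> j)"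

text \<open>The effect on index pairs of exchanging the colours: \<open>e\<^sub>i\<close> and \<open>f\<^sub>j\<close> become \<open>f\<^bsub>\<alpha> i\<^esub>\<close> and
  \<open>e\<^bsub>\<beta> j\<^esub>\<close>, and pairs list the index of the \<open>e\<close>-generator first.\<close>

definition cross :: "(nat \<Rightarrow> nat) \<Rightarrow> (nat \<Rightarrow> nat) \<Rightarrow> nat \<times> nat \<Rightarrow> nat \<times> nat" where
  "cross \<alpha> \<beta> x = (\<beta> (snd x), \<alpha> (fst x))"

lemma step_congI:
  assumes "(i, j) \<in> grid n m" "\<theta> (i, j) = (i', j')" "(i', j') \<in> grid n m"
  shows "([Gen_e i, Gen_f j], [Gen_f j', Gen_e i']) \<in> word_cong n m \<theta>"
proof -
  have "commutation_step n m \<theta> [Gen_e i, Gen_f j] [Gen_f j', Gen_e i']"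
    using assms by (simp add: commutation_step_pair)
  then show ?thesis
    using assms by (auto simp: word_cong_def words_gens gens_def intro: r_into_equivclp)
qed

lemma relabel_iso:
  assumes \<theta>: "\<theta> permutes grid n m" "\<theta>' permutes grid n m"
    and ab: "\<alpha> permutes {1..n}" "\<beta> permutes {1..m}"
    and rel: "\<And>x. x \<in> grid n m \<Longrightarrow> \<theta>' (map_prod \<alpha> \<beta> x) = map_prod \<alpha> \<beta> (\<theta> x)"
  shows "theta_semigroup n m \<theta> \<cong> theta_semigroup n m \<theta>'"
proof (rule theta_semigroup_isoI)
  have main: "(map (relabel \<alpha> \<beta>) [Gen_e i, Gen_f j],
      map (relabel \<alpha> \<beta>) [Gen_f (snd (\<theta> (i, j))), Gen_e (fst (\<theta> (i, j)))]) \<in> word_cong n m \<theta>'"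
    if "\<theta> permutes grid n m" "\<alpha> permutes {1..n}" "\<beta> permutes {1..m}"
      "\<And>x. x \<in> grid n m \<Longrightarrow> \<theta>' (map_prod \<alpha> \<beta> x) = map_prod \<alpha> \<beta> (\<theta> x)" "(i, j) \<in> grid n m"
    for \<theta> \<theta>' \<alpha> \<beta> i j
  proof -
    obtain i' j' where ij': "\<theta> (i, j) = (i', j')" by fastforce
    have "(i', j') \<in> grid n m" using permutes_in_image[OF that(1)] that(5) ij' by metis
    then show ?thesis
      using step_congI[of "\<alpha> i" "\<beta> j" n m \<theta>' "\<alpha> i'" "\<beta> j'"] that(4)[OF that(5)] that(5) ij'
        permutes_in_image[OF that(2)] permutes_in_image[OF that(3)] by simp
  qed
  note inv = permutes_inverses[OF ab(1)] permutes_inverses[OF ab(2)]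
  note im = permutes_in_image[OF ab(1)] permutes_in_image[OF ab(2)]
    permutes_in_image[OF permutes_inv[OF ab(1)]] permutes_in_image[OF permutes_inv[OF ab(2)]]
  show "relabel \<alpha> \<beta> ` gens n m \<subseteq> gens n m" "relabel (perm_inv \<alpha>) (perm_inv \<beta>) ` gens n m \<subseteq> gens n m"
    using im by (force simp: gens_def)+
  show "relabel (perm_inv \<alpha>) (perm_inv \<beta>) (relabel \<alpha> \<beta> a) = a" "relabel \<alpha> \<beta> (relabel (perm_inv \<alpha>) (perm_inv \<beta>) a) = a" for a
    by (cases a; simp add: inv)+
  show "(map (relabel \<alpha> \<beta>) [Gen_e i, Gen_f j],
      map (relabel \<alpha> \<beta>) [Gen_f (snd (\<theta> (i, j))), Gen_e (fst (\<theta> (i, j)))]) \<in> word_cong n m \<theta>'"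
    if "(i, j) \<in> grid n m" for i j
    by (rule main[OF \<theta>(1) ab rel that])
  have rel': "\<theta> (map_prod (perm_inv \<alpha>) (perm_inv \<beta>) y) = map_prod (perm_inv \<alpha>) (perm_inv \<beta>) (\<theta>' y)"
    if "y \<in> grid n m" for y
  proof -
    have x: "map_prod (perm_inv \<alpha>) (perm_inv \<beta>) y \<in> grid n m" using that im by (cases y) simp
    have y: "map_prod \<alpha> \<beta> (map_prod (perm_inv \<alpha>) (perm_inv \<beta>) y) = y" by (cases y) (simp add: inv)
    show ?thesis
      using rel[OF x] unfolding y by (cases "\<theta> (map_prod (perm_inv \<alpha>) (perm_inv \<beta>) y)") (simp add: inv)
  qed
  show "(map (relabel (perm_inv \<alpha>) (perm_inv \<beta>)) [Gen_e i, Gen_f j],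
      map (relabel (perm_inv \<alpha>) (perm_inv \<beta>)) [Gen_f (snd (\<theta>' (i, j))), Gen_e (fst (\<theta>' (i, j)))])
        \<in> word_cong n m \<theta>"
    if "(i, j) \<in> grid n m" for i j
    by (rule main[OF \<theta>(2) permutes_inv[OF ab(1)] permutes_inv[OF ab(2)] rel' that])
qed

text \<open>An exchange of colours turns \<open>e\<^sub>i f\<^sub>j = f\<^sub>j\<^sub>' e\<^sub>i\<^sub>'\<close> into
  \<open>f\<^bsub>\<alpha> i\<^esub> e\<^bsub>\<beta> j\<^esub> = e\<^bsub>\<beta> j'\<^esub> f\<^bsub>\<alpha> i'\<^esub>\<close>, which has the \<open>ef\<close>-word on the right. This is why
  \<open>\<theta>\<close> occurs on the argument side in the hypothesis, that is, inverted.\<close>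

lemma exchange_iso:
  assumes \<theta>: "\<theta> permutes grid n n" "\<theta>' permutes grid n n"
    and ab: "\<alpha> permutes {1..n}" "\<beta> permutes {1..n}"
    and rel: "\<And>x. x \<in> grid n n \<Longrightarrow> \<theta>' (cross \<alpha> \<beta> (\<theta> x)) = cross \<alpha> \<beta> x"
  shows "theta_semigroup n n \<theta> \<cong> theta_semigroup n n \<theta>'"
proof (rule theta_semigroup_isoI)
  have main: "(map (exchange \<alpha> \<beta>) [Gen_e i, Gen_f j],
      map (exchange \<alpha> \<beta>) [Gen_f (snd (\<theta> (i, j))), Gen_e (fst (\<theta> (i, j)))]) \<in> word_cong n n \<theta>'"
    if "\<theta> permutes grid n n" "\<alpha> permutes {1..n}" "\<beta> permutes {1..n}"
      "\<And>x. x \<in> grid n n \<Longrightarrow> \<theta>' (cross \<alpha> \<beta> (\<theta> x)) = cross \<alpha> \<beta> x" "(i, j) \<in> grid n n"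
    for \<theta> \<theta>' \<alpha> \<beta> i j
  proof -
    obtain i' j' where ij': "\<theta> (i, j) = (i', j')" by fastforce
    have "(i', j') \<in> grid n n" using permutes_in_image[OF that(1)] that(5) ij' by metis
    then have "([Gen_e (\<beta> j'), Gen_f (\<alpha> i')], [Gen_f (\<alpha> i), Gen_e (\<beta> j)]) \<in> word_cong n n \<theta>'"
      using that(4)[OF that(5)] that(5) ij'
        permutes_in_image[OF that(2)] permutes_in_image[OF that(3)]
      by (intro step_congI) (simp_all add: cross_def)
    then show ?thesis using equiv_word_cong[of n n \<theta>'] ij' by (auto dest: equivE symD)
  qed
  note inv = permutes_inverses[OF ab(1)] permutes_inverses[OF ab(2)]
  note im = permutes_in_image[OF ab(1)] permutes_in_image[OF ab(2)]
    permutes_in_image[OF permutes_inv[OF ab(1)]] permutes_in_image[OF permutes_inv[OF ab(2)]]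
  show "exchange \<alpha> \<beta> ` gens n n \<subseteq> gens n n" "exchange (perm_inv \<beta>) (perm_inv \<alpha>) ` gens n n \<subseteq> gens n n"
    using im by (force simp: gens_def)+
  show "exchange (perm_inv \<beta>) (perm_inv \<alpha>) (exchange \<alpha> \<beta> a) = a"
    "exchange \<alpha> \<beta> (exchange (perm_inv \<beta>) (perm_inv \<alpha>) a) = a" for a
    by (cases a; simp add: inv)+
  show "(map (exchange \<alpha> \<beta>) [Gen_e i, Gen_f j],
      map (exchange \<alpha> \<beta>) [Gen_f (snd (\<theta> (i, j))), Gen_e (fst (\<theta> (i, j)))]) \<in> word_cong n n \<theta>'"
    if "(i, j) \<in> grid n n" for i j
    by (rule main[OF \<theta>(1) ab rel that])
  have rel': "\<theta> (cross (perm_inv \<beta>) (perm_inv \<alpha>) (\<theta>' y)) = cross (perm_inv \<beta>) (perm_inv \<alpha>) y"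
    if y: "y \<in> grid n n" for y
  proof -
    have cc: "cross \<alpha> \<beta> (cross (perm_inv \<beta>) (perm_inv \<alpha>) z) = z" "cross (perm_inv \<beta>) (perm_inv \<alpha>) (cross \<alpha> \<beta> z) = z" for z
      by (simp_all add: cross_def inv)
    have "\<theta>' y \<in> grid n n" using permutes_in_image[OF \<theta>(2)] y by metis
    then have z: "cross (perm_inv \<beta>) (perm_inv \<alpha>) (\<theta>' y) \<in> grid n n"
      using im by (simp add: cross_def mem_Times_iff)
    have "\<theta>' (cross \<alpha> \<beta> (\<theta> (cross (perm_inv \<beta>) (perm_inv \<alpha>) (\<theta>' y)))) = \<theta>' y"
      using rel[OF z] cc by simp
    then have "cross \<alpha> \<beta> (\<theta> (cross (perm_inv \<beta>) (perm_inv \<alpha>) (\<theta>' y))) = y"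
      using permutes_inj[OF \<theta>(2)] by (simp add: inj_eq)
    then show ?thesis using cc by metis
  qed
  show "(map (exchange (perm_inv \<beta>) (perm_inv \<alpha>)) [Gen_e i, Gen_f j],
      map (exchange (perm_inv \<beta>) (perm_inv \<alpha>)) [Gen_f (snd (\<theta>' (i, j))), Gen_e (fst (\<theta>' (i, j)))])
        \<in> word_cong n n \<theta>"
    if "(i, j) \<in> grid n n" for i j
    by (rule main[OF \<theta>(2) permutes_inv[OF ab(2)] permutes_inv[OF ab(1)] rel' that])
qed

lemma iso_on_gens:
  assumes h: "h \<in> iso (theta_semigroup n m \<theta>) (theta_semigroup n m \<theta>')"
  shows "\<exists>g. bij_betw g (gens n m) (gens n m) \<and> (\<forall>a\<in>gens n m. h {[a]} = {[g a]})"
proof -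
  let ?M = "theta_semigroup n m \<theta>" and ?N = "theta_semigroup n m \<theta>'"
  have bij: "bij_betw h (carrier ?M) (carrier ?N)" using h by (simp add: iso_def)
  have carr: "indecomposable M x \<Longrightarrow> x \<in> carrier M" for M :: "gen list set monoid" and x
    by (simp add: indecomposable_def)
  have ind: "indecomposable ?N (h x) \<longleftrightarrow> indecomposable ?M x" if "x \<in> carrier ?M" for x
    using iso_indecomposable[OF theta_semigroup_monoid theta_semigroup_monoid h that] .
  have "\<exists>b\<in>gens n m. h {[a]} = {[b]}" if "a \<in> gens n m" for a
    using that ind[of "{[a]}"] carr[of ?M "{[a]}"] by (auto simp: indecomposable_iff)
  then obtain g where g: "\<And>a. a \<in> gens n m \<Longrightarrow> g a \<in> gens n m \<and> h {[a]} = {[g a]}"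
    by metis
  have in_carr: "{[a]} \<in> carrier ?M" if "a \<in> gens n m" for a
    using that carr[of ?M "{[a]}"] by (auto simp: indecomposable_iff)
  have "inj_on g (gens n m)"
  proof (rule inj_onI)
    fix a b assume ab: "a \<in> gens n m" "b \<in> gens n m" "g a = g b"
    then have "h {[a]} = h {[b]}" using g by simp
    then have "{[a]} = {[b]}"
      using bij in_carr ab by (auto simp: bij_betw_def dest: inj_onD)
    then show "a = b" by simp
  qed
  moreover have "finite (gens n m)" by (simp add: gens_def)
  ultimately have "bij_betw g (gens n m) (gens n m)"
    using g by (simp add: bij_betw_def endo_inj_surj image_subsetI)
  then show ?thesis using g by blast
qed

text \<open>The image of a relation \<open>e\<^sub>i f\<^sub>j = f\<^sub>j\<^sub>' e\<^sub>i\<^sub>'\<close> is an equality between two different two-letter words,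
  hence again a relation, read forwards or backwards. In both cases the images of \<open>e\<^sub>i\<close> and \<open>f\<^sub>j\<close>
  have different colours. As this holds for all \<open>i\<close> and \<open>j\<close>, the colour of the image of \<open>e\<^sub>1\<close>
  decides between the two alternatives.\<close>

lemma iso_imp_relabelling_or_exchange:
  assumes \<theta>: "\<theta> permutes grid n m" "\<theta>' permutes grid n m" and pos: "0 < n" "0 < m"
    and iso: "theta_semigroup n m \<theta> \<cong> theta_semigroup n m \<theta>'"
  shows "(\<exists>\<alpha> \<beta>. \<alpha> permutes {1..n} \<and> \<beta> permutes {1..m} \<and>
      (\<forall>x\<in>grid n m. \<theta>' (map_prod \<alpha> \<beta> x) = map_prod \<alpha> \<beta> (\<theta> x))) \<or>
    (n = m \<and> (\<exists>\<alpha> \<beta>. \<alpha> permutes {1..n} \<and> \<beta> permutes {1..n} \<and>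
      (\<forall>x\<in>grid n n. \<theta>' (cross \<alpha> \<beta> (\<theta> x)) = cross \<alpha> \<beta> x)))"
proof -
  let ?M = "theta_semigroup n m \<theta>" and ?N = "theta_semigroup n m \<theta>'"
  obtain h where h: "h \<in> iso ?M ?N" using iso by (auto simp: is_iso_def)
  obtain g where g: "bij_betw g (gens n m) (gens n m)"
    "\<And>a. a \<in> gens n m \<Longrightarrow> h {[a]} = {[g a]}"
    using iso_on_gens[OF h] by blast
  have hom: "h \<in> hom ?M ?N" using h by (simp add: iso_def)
  have ggen: "g a \<in> gens n m" if "a \<in> gens n m" for a using g(1) that by (auto simp: bij_betw_def)
  have ginj: "g a = g b \<longleftrightarrow> a = b" if "a \<in> gens n m" "b \<in> gens n m" for a b
    using g(1) that by (auto simp: bij_betw_def dest: inj_onD)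
  have W: "[a] \<in> words n m" if "a \<in> gens n m" for a using that by (simp add: words_gens)
  have W2: "[a, b] \<in> words n m" if "a \<in> gens n m" "b \<in> gens n m" for a b using that by (simp add: words_gens)
  have eg[simp]: "Gen_e i \<in> gens n m \<longleftrightarrow> i \<in> {1..n}" "Gen_f i \<in> gens n m \<longleftrightarrow> i \<in> {1..m}" for i
    by (auto simp: gens_def)
  have h2: "h (word_class n m \<theta> [a, b]) = word_class n m \<theta>' [g a, g b]"
    if "a \<in> gens n m" "b \<in> gens n m" for a b
  proof -
    have single: "word_class n m \<theta>'' [c] = {[c]}" if "c \<in> gens n m" for c \<theta>''
      using word_class_short W[OF that] by simp
    have "word_class n m \<theta> [a, b] = {[a]} \<otimes>\<^bsub>?M\<^esub> {[b]}"
      using theta_semigroup_mult[of "[a]" n m "[b]" \<theta>] W that single by simp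
    moreover have "{[a]} \<in> carrier ?M" "{[b]} \<in> carrier ?M"
      using that indecomposable_iff[of n m \<theta>] by (auto simp: indecomposable_def)
    ultimately have "h (word_class n m \<theta> [a, b]) = {[g a]} \<otimes>\<^bsub>?N\<^esub> {[g b]}"
      using hom_mult[OF hom] g(2) that by simp
    also have "\<dots> = word_class n m \<theta>' [g a, g b]"
      using theta_semigroup_mult[of "[g a]" n m "[g b]" \<theta>'] W ggen that single by simp
    finally show ?thesis .
  qed
  have key: "(\<exists>p\<in>{1..n}. \<exists>q\<in>{1..m}. g (Gen_e i) = Gen_e p \<and> g (Gen_f j) = Gen_f q \<and>
        g (Gen_f (snd (\<theta> (i, j)))) = Gen_f (snd (\<theta>' (p, q))) \<and>
        g (Gen_e (fst (\<theta> (i, j)))) = Gen_e (fst (\<theta>' (p, q)))) \<or>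
      (\<exists>p\<in>{1..n}. \<exists>q\<in>{1..m}. g (Gen_f (snd (\<theta> (i, j)))) = Gen_e p \<and>
        g (Gen_e (fst (\<theta> (i, j)))) = Gen_f q \<and>
        g (Gen_e i) = Gen_f (snd (\<theta>' (p, q))) \<and> g (Gen_f j) = Gen_e (fst (\<theta>' (p, q))))"
    if ij: "(i, j) \<in> grid n m" for i j
  proof -
    obtain i' j' where ij': "\<theta> (i, j) = (i', j')" by fastforce
    have in': "(i', j') \<in> grid n m" using permutes_in_image[OF \<theta>(1)] ij ij' by metis
    have e: "Gen_e i \<in> gens n m" "Gen_f j \<in> gens n m" "Gen_e i' \<in> gens n m" "Gen_f j' \<in> gens n m"
      using ij in' by auto
    have "word_class n m \<theta> [Gen_e i, Gen_f j] = word_class n m \<theta> [Gen_f j', Gen_e i']"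
      using step_congI[of i j n m \<theta> i' j', OF ij ij' in'] by (rule equiv_class_eq[OF equiv_word_cong])
    then have "word_class n m \<theta>' [g (Gen_e i), g (Gen_f j)] = word_class n m \<theta>' [g (Gen_f j'), g (Gen_e i')]"
      using h2 e by metis
    then have "([g (Gen_e i), g (Gen_f j)], [g (Gen_f j'), g (Gen_e i')]) \<in> word_cong n m \<theta>'"
      using word_class_eq_iff W2 ggen e by metis
    moreover have "inj_on \<theta>' (grid n m)" using permutes_inj[OF \<theta>(2)] by (rule inj_on_subset) simp
    moreover have "g (Gen_e i) \<noteq> g (Gen_f j')" using ginj e by simp
    ultimately show ?thesis
      using word_cong_pair[of \<theta>' n m] unfolding commutation_step_pair ij' by fastforce
  qed
  \<comment> \<open>A relation, read in either direction, joins letters of different colours.\<close>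
  have colour: "is_gen_e (g (Gen_e i)) \<noteq> is_gen_e (g (Gen_f j))" if "(i, j) \<in> grid n m" for i j
    using key[OF that] by auto
  show ?thesis
  proof (cases "is_gen_e (g (Gen_e 1))")
    case True
    have f: "\<not> is_gen_e (g (Gen_f j))" if "j \<in> {1..m}" for j
      using colour[of 1 j] that pos True by simp
    have e: "is_gen_e (g (Gen_e i))" if "i \<in> {1..n}" for i
      using colour[of i 1] f[of 1] that pos by simp
    have "\<exists>p\<in>{1..n}. g (Gen_e i) = Gen_e p" if "i \<in> {1..n}" for i
      using e[OF that] ggen[of "Gen_e i"] that by (cases "g (Gen_e i)") auto
    then obtain a where a: "\<And>i. i \<in> {1..n} \<Longrightarrow> a i \<in> {1..n} \<and> g (Gen_e i) = Gen_e (a i)" by metis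
    have "\<exists>p\<in>{1..m}. g (Gen_f i) = Gen_f p" if "i \<in> {1..m}" for i
      using f[OF that] ggen[of "Gen_f i"] that by (cases "g (Gen_f i)") auto
    then obtain b where b: "\<And>i. i \<in> {1..m} \<Longrightarrow> b i \<in> {1..m} \<and> g (Gen_f i) = Gen_f (b i)" by metis
    define \<alpha> where "\<alpha> = perm_restrict a {1..n}"
    define \<beta> where "\<beta> = perm_restrict b {1..m}"
    have "inj_on a {1..n}" using ginj a eg(1) by (metis gen.inject(1) inj_onI)
    then have \<alpha>: "\<alpha> permutes {1..n}"
      unfolding \<alpha>_def using a by (intro perm_restrict_permutes) auto
    have "inj_on b {1..m}" using ginj b eg(2) by (metis gen.inject(2) inj_onI)
    then have \<beta>: "\<beta> permutes {1..m}"
      unfolding \<beta>_def using b by (intro perm_restrict_permutes) auto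
    have ga: "g (Gen_e i) = Gen_e (\<alpha> i)" if "i \<in> {1..n}" for i
      using a[OF that] that by (simp add: \<alpha>_def perm_restrict_def)
    have gb: "g (Gen_f i) = Gen_f (\<beta> i)" if "i \<in> {1..m}" for i
      using b[OF that] that by (simp add: \<beta>_def perm_restrict_def)
    have "\<theta>' (map_prod \<alpha> \<beta> x) = map_prod \<alpha> \<beta> (\<theta> x)" if x: "x \<in> grid n m" for x
    proof -
      have "\<theta> x \<in> grid n m" using permutes_in_image[OF \<theta>(1)] x by metis
      then have "g (Gen_f (snd (\<theta> x))) = Gen_f (\<beta> (snd (\<theta> x)))" "g (Gen_e (fst (\<theta> x))) = Gen_e (\<alpha> (fst (\<theta> x)))"
        using ga gb by (auto simp: mem_Times_iff)
      moreover have "g (Gen_e (fst x)) = Gen_e (\<alpha> (fst x))" "g (Gen_f (snd x)) = Gen_f (\<beta> (snd x))"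
        using x ga gb by (auto simp: mem_Times_iff)
      ultimately show ?thesis
        using key[of "fst x" "snd x"] x by (auto simp: prod_eq_iff map_prod_def split: prod.splits)
    qed
    then show ?thesis using \<alpha> \<beta> by blast
  next
    case False
    have f: "is_gen_e (g (Gen_f j))" if "j \<in> {1..m}" for j
      using colour[of 1 j] that pos False by simp
    have e: "\<not> is_gen_e (g (Gen_e i))" if "i \<in> {1..n}" for i
      using colour[of i 1] f[of 1] that pos by simp
    have "\<exists>p\<in>{1..m}. g (Gen_e i) = Gen_f p" if "i \<in> {1..n}" for i
      using e[OF that] ggen[of "Gen_e i"] that by (cases "g (Gen_e i)") auto
    then obtain a where a: "\<And>i. i \<in> {1..n} \<Longrightarrow> a i \<in> {1..m} \<and> g (Gen_e i) = Gen_f (a i)" by metis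
    have "\<exists>p\<in>{1..n}. g (Gen_f i) = Gen_e p" if "i \<in> {1..m}" for i
      using f[OF that] ggen[of "Gen_f i"] that by (cases "g (Gen_f i)") auto
    then obtain b where b: "\<And>i. i \<in> {1..m} \<Longrightarrow> b i \<in> {1..n} \<and> g (Gen_f i) = Gen_e (b i)" by metis
    have ia: "inj_on a {1..n}" using ginj a eg(1) by (metis gen.inject(1) inj_onI)
    have ib: "inj_on b {1..m}" using ginj b eg(2) by (metis gen.inject(2) inj_onI)
    \<comment> \<open>The two colour classes of generators are injected into each other.\<close>
    have "n \<le> m" using card_inj_on_le[OF ia, of "{1..m}"] a by (simp add: image_subset_iff)
    moreover have "m \<le> n" using card_inj_on_le[OF ib, of "{1..n}"] b by (simp add: image_subset_iff)
    ultimately have nm: "n = m" by simp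
    define \<alpha> where "\<alpha> = perm_restrict a {1..n}"
    define \<beta> where "\<beta> = perm_restrict b {1..n}"
    have \<alpha>: "\<alpha> permutes {1..n}"
      unfolding \<alpha>_def using a ia nm by (intro perm_restrict_permutes) auto
    have \<beta>: "\<beta> permutes {1..n}"
      unfolding \<beta>_def using b ib nm by (intro perm_restrict_permutes) auto
    have ga: "g (Gen_e i) = Gen_f (\<alpha> i)" if "i \<in> {1..n}" for i
      using a[OF that] that by (simp add: \<alpha>_def perm_restrict_def)
    have gb: "g (Gen_f i) = Gen_e (\<beta> i)" if "i \<in> {1..m}" for i
      using b[OF that] that nm by (simp add: \<beta>_def perm_restrict_def)
    have "\<theta>' (cross \<alpha> \<beta> (\<theta> x)) = cross \<alpha> \<beta> x" if x: "x \<in> grid n m" for x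
    proof -
      have "\<theta> x \<in> grid n m" using permutes_in_image[OF \<theta>(1)] x by metis
      then have "g (Gen_f (snd (\<theta> x))) = Gen_e (\<beta> (snd (\<theta> x)))" "g (Gen_e (fst (\<theta> x))) = Gen_f (\<alpha> (fst (\<theta> x)))"
        using ga gb by (auto simp: mem_Times_iff)
      moreover have "g (Gen_e (fst x)) = Gen_f (\<alpha> (fst x))" "g (Gen_f (snd x)) = Gen_e (\<beta> (snd x))"
        using x ga gb by (auto simp: mem_Times_iff)
      ultimately show ?thesis
        using key[of "fst x" "snd x"] x by (auto simp: prod_eq_iff cross_def)
    qed
    then show ?thesis using \<alpha> \<beta> nm by blast
  qed
qed

section \<open>Isomorphism classes as orbits of a group\<close>

text \<open>The sign \<open>True\<close> stands for an exchange of colours, which conjugates the inverse of \<open>\<theta>\<close>.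
  Since conjugation commutes with inversion, this is a left action when signs multiply as in the
  group of two elements.\<close>

definition signed_conj :: "bool \<times> ('a \<Rightarrow> 'a) \<Rightarrow> ('a \<Rightarrow> 'a) \<Rightarrow> 'a \<Rightarrow> 'a" where
  "signed_conj k \<theta> = snd k \<circ> (if fst k then perm_inv \<theta> else \<theta>) \<circ> perm_inv (snd k)"

definition signed_mult :: "bool \<times> ('a \<Rightarrow> 'a) \<Rightarrow> bool \<times> ('a \<Rightarrow> 'a) \<Rightarrow> bool \<times> ('a \<Rightarrow> 'a)" where
  "signed_mult k l = (fst k \<noteq> fst l, snd k \<circ> snd l)"

definition signed_group :: "(bool \<times> ('a \<Rightarrow> 'a)) set \<Rightarrow> (bool \<times> ('a \<Rightarrow> 'a)) monoid" where
  "signed_group K = \<lparr>carrier = K, monoid.mult = signed_mult, one = (False, id)\<rparr>"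

lemma signed_conj_permutes:
  "\<theta> permutes S \<Longrightarrow> snd k permutes S \<Longrightarrow> signed_conj k \<theta> permutes S"
  by (auto simp: signed_conj_def intro!: permutes_compose permutes_inv)

lemma perm_inv_comp:
  "p permutes S \<Longrightarrow> q permutes S \<Longrightarrow> perm_inv (p \<circ> q) = perm_inv q \<circ> perm_inv p"
  by (simp add: o_inv_distrib permutes_bij)

lemma signed_conj_mult:
  assumes "\<theta> permutes S" "snd k permutes S" "snd l permutes S"
  shows "signed_conj (signed_mult k l) \<theta> = signed_conj k (signed_conj l \<theta>)"
proof -
  have inv: "perm_inv (snd l \<circ> \<psi> \<circ> perm_inv (snd l)) = snd l \<circ> perm_inv \<psi> \<circ> perm_inv (snd l)"
    if "\<psi> permutes S" for \<psi>
    by (rule inv_unique_comp)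
      (simp_all add: fun_eq_iff permutes_inverses[OF assms(3)] permutes_inverses[OF that])
  have pi: "perm_inv (perm_inv \<theta>) = \<theta>" using assms(1) by (simp add: inv_inv_eq permutes_bij)
  show ?thesis
    using inv[OF assms(1)] inv[OF permutes_inv[OF assms(1)]] pi
    by (simp add: signed_conj_def signed_mult_def perm_inv_comp[OF assms(2,3)] o_assoc)
qed

lemma signed_conj_one: "signed_conj (False, id) \<theta> = \<theta>"
  by (simp add: signed_conj_def inv_id)

text \<open>Subgroups of the product of a group of two elements with the symmetric group of \<open>S\<close>.\<close>

locale signed_perm_group =
  fixes K :: "(bool \<times> ('a \<Rightarrow> 'a)) set" and S :: "'a set"
  assumes perm: "k \<in> K \<Longrightarrow> snd k permutes S"
    and one: "(False, id) \<in> K"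
    and mult: "k \<in> K \<Longrightarrow> l \<in> K \<Longrightarrow> signed_mult k l \<in> K"
    and inverse: "k \<in> K \<Longrightarrow> (fst k, perm_inv (snd k)) \<in> K"
begin

lemma conj_closed: "k \<in> K \<Longrightarrow> \<theta> permutes S \<Longrightarrow> signed_conj k \<theta> permutes S"
  by (rule signed_conj_permutes[OF _ perm])

lemma group_signed: "group (signed_group K)"
proof (rule groupI)
  fix x assume x: "x \<in> carrier (signed_group K)"
  have "snd x permutes S" using perm x by (simp add: signed_group_def)
  then have "signed_mult (fst x, perm_inv (snd x)) x = (False, id)"
    by (simp add: signed_mult_def permutes_inv_o)
  then show "\<exists>y\<in>carrier (signed_group K). y \<otimes>\<^bsub>signed_group K\<^esub> x = \<one>\<^bsub>signed_group K\<^esub>"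
    using inverse x by (auto simp: signed_group_def)
qed (use one mult in \<open>auto simp: signed_group_def signed_mult_def o_assoc\<close>)

lemma signed_action:
  "group_action (signed_group K) {\<theta>. \<theta> permutes S}
    (\<lambda>k. restrict (signed_conj k) {\<theta>. \<theta> permutes S})"
proof -
  let ?E = "{\<theta>. \<theta> permutes S}"
  let ?\<phi> = "\<lambda>k. restrict (signed_conj k) ?E"
  have cancel: "signed_conj k (signed_conj l \<theta>) = \<theta>"
    if "k \<in> K" "l \<in> K" "\<theta> permutes S" "signed_mult k l = (False, id)" for k l \<theta>
    using signed_conj_mult[of \<theta> S k l] that perm signed_conj_one by metis
  have Bij: "?\<phi> k \<in> Bij ?E" if k: "k \<in> K" for k
  proof -
    let ?k' = "(fst k, perm_inv (snd k))"
    have "signed_mult k ?k' = (False, id)" "signed_mult ?k' k = (False, id)"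
      using perm[OF k] by (simp_all add: signed_mult_def permutes_inv_o)
    then have "bij_betw (signed_conj k) ?E ?E"
      using cancel[OF k inverse[OF k]] cancel[OF inverse[OF k] k]
        signed_conj_permutes[OF _ perm[OF k]] signed_conj_permutes[OF _ perm[OF inverse[OF k]]]
      by (intro bij_betw_byWitness[where f' = "signed_conj ?k'"]) auto
    then show ?thesis
      by (auto simp: Bij_def intro: bij_betw_cong[THEN iffD1, rotated])
  qed
  have "?\<phi> \<in> hom (signed_group K) (BijGroup ?E)"
  proof (rule homI)
    fix k l assume "k \<in> carrier (signed_group K)" "l \<in> carrier (signed_group K)"
    then have kl: "k \<in> K" "l \<in> K" by (auto simp: signed_group_def)
    have "?\<phi> (signed_mult k l) = compose ?E (?\<phi> k) (?\<phi> l)"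
      using signed_conj_mult[OF _ perm[OF kl(1)] perm[OF kl(2)]] conj_closed[OF kl(2)]
      by (auto simp: compose_def fun_eq_iff restrict_def)
    then show "?\<phi> (k \<otimes>\<^bsub>signed_group K\<^esub> l) = ?\<phi> k \<otimes>\<^bsub>BijGroup ?E\<^esub> ?\<phi> l"
      using Bij kl by (simp add: signed_group_def BijGroup_def)
  qed (use Bij in \<open>auto simp: signed_group_def BijGroup_def\<close>)
  then show ?thesis
    by (simp add: group_action_def group_hom_def group_hom_axioms_def group_signed group_BijGroup)
qed

text \<open>Burnside's lemma, transported along a parametrisation \<open>f\<close> of the objects to be classified by
  permutations. Even if \<open>f\<close> identifies some permutations, the classes correspond to the
  orbits, because \<open>R\<close> pulls back to the orbit relation.\<close>

lemma card_signed_classes: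
  assumes fin: "finite S"
    and R: "\<And>\<theta> \<theta>'. \<theta> permutes S \<Longrightarrow> \<theta>' permutes S \<Longrightarrow>
      (f \<theta>, f \<theta>') \<in> R \<longleftrightarrow> (\<exists>k\<in>K. signed_conj k \<theta> = \<theta>')"
    and sub: "R \<subseteq> f ` {\<theta>. \<theta> permutes S} \<times> f ` {\<theta>. \<theta> permutes S}"
  shows "card ((f ` {\<theta>. \<theta> permutes S}) // R) * card K =
    (\<Sum>k\<in>K. card {\<theta>. \<theta> permutes S \<and> signed_conj k \<theta> = \<theta>})"
proof -
  let ?E = "{\<theta>. \<theta> permutes S}"
  let ?\<phi> = "\<lambda>k. restrict (signed_conj k) ?E"
  let ?G = "signed_group K"
  interpret group_action ?G ?E ?\<phi> by (rule signed_action)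
  have finE: "finite ?E" using fin by (rule finite_permutations)
  have "K \<subseteq> UNIV \<times> ?E" using perm by (auto simp: mem_Times_iff)
  then have finK: "finite K" by (rule finite_subset) (simp add: finE)
  have orb: "orbit ?G ?\<phi> x = {y \<in> ?E. (f x, f y) \<in> R}" if "x \<in> ?E" for x
  proof -
    have "orbit ?G ?\<phi> x = {y. \<exists>k\<in>K. signed_conj k x = y}"
      using that by (auto simp: orbit_def signed_group_def)
    then show ?thesis using that by (auto simp: R conj_closed)
  qed
  have cls: "R `` {f x} = f ` orbit ?G ?\<phi> x" if "x \<in> ?E" for x
    using that sub by (auto simp: orb)
  have "card ((f ` ?E) // R) = card ((\<lambda>x. R `` {f x}) ` ?E)"
    by (rule arg_cong[where f = card]) (auto simp: quotient_def)
  also have "\<dots> = card ((\<lambda>C. f ` C) ` orbits ?G ?E ?\<phi>)"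
    using cls by (intro arg_cong[where f = card]) (auto simp: orbits_def image_def)
  also have "\<dots> = card (orbits ?G ?E ?\<phi>)"
  proof (rule card_image, rule inj_onI)
    fix C D assume "C \<in> orbits ?G ?E ?\<phi>" "D \<in> orbits ?G ?E ?\<phi>" and eq: "f ` C = f ` D"
    then obtain x y where x: "x \<in> ?E" "C = orbit ?G ?\<phi> x" and y: "y \<in> ?E" "D = orbit ?G ?\<phi> y"
      by (auto simp: orbits_def)
    have "f x \<in> f ` D" using orbit_refl[OF x(1)] x(2) eq by blast
    then have "(f y, f x) \<in> R" using y orb by auto
    then have "x \<in> D" using x y orb by auto
    moreover have "x \<in> C" using orbit_refl[OF x(1)] x(2) by simp
    ultimately show "C = D"
      using disjoint_union[of C D] \<open>C \<in> orbits ?G ?E ?\<phi>\<close> \<open>D \<in> orbits ?G ?E ?\<phi>\<close> by blast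
  qed
  finally have "card ((f ` ?E) // R) * card K = (\<Sum>k\<in>K. card (invariants ?E ?\<phi> k))"
    using burnside[OF _ finE] finK by (simp add: signed_group_def order_def)
  also have "\<dots> = (\<Sum>k\<in>K. card {\<theta>. \<theta> permutes S \<and> signed_conj k \<theta> = \<theta>})"
    by (intro sum.cong refl arg_cong[where f = card]) (auto simp: invariants_def)
  finally show ?thesis .
qed

end

text \<open>Forms of the action free of inverses, which match the relations between generators and
  are convenient for counting.\<close>

lemma signed_conj_eq_iff:
  assumes "\<tau> permutes S" "\<theta> permutes S" "\<theta>' permutes S"
  shows "signed_conj (False, \<tau>) \<theta> = \<theta>' \<longleftrightarrow> (\<forall>x\<in>S. \<theta>' (\<tau> x) = \<tau> (\<theta> x))"
    and "signed_conj (True, \<tau>) \<theta> = \<theta>' \<longleftrightarrow> (\<forall>x\<in>S. \<theta>' (\<tau> (\<theta> x)) = \<tau> x)"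
proof -
  have *: "\<tau> \<circ> \<psi> \<circ> perm_inv \<tau> = \<theta>' \<longleftrightarrow> (\<forall>x\<in>S. \<theta>' (\<tau> x) = \<tau> (\<psi> x))"
    if \<psi>: "\<psi> permutes S" for \<psi>
  proof -
    have "\<tau> \<circ> \<psi> \<circ> perm_inv \<tau> = \<theta>' \<longleftrightarrow> (\<forall>x. \<theta>' (\<tau> x) = \<tau> (\<psi> x))"
      unfolding fun_eq_iff comp_apply using permutes_inverses[OF assms(1)] by metis
    also have "\<dots> \<longleftrightarrow> (\<forall>x\<in>S. \<theta>' (\<tau> x) = \<tau> (\<psi> x))"
      using permutes_not_in[OF assms(1)] permutes_not_in[OF assms(3)] permutes_not_in[OF \<psi>] by metis
    finally show ?thesis .
  qed
  show "signed_conj (False, \<tau>) \<theta> = \<theta>' \<longleftrightarrow> (\<forall>x\<in>S. \<theta>' (\<tau> x) = \<tau> (\<theta> x))"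
    using *[OF assms(2)] by (simp add: signed_conj_def)
  have "(\<forall>x\<in>S. \<theta>' (\<tau> x) = \<tau> (perm_inv \<theta> x)) \<longleftrightarrow> (\<forall>x\<in>S. \<theta>' (\<tau> (\<theta> x)) = \<tau> x)"
    using permutes_inverses[OF assms(2)] permutes_in_image[OF assms(2)] by metis
  then show "signed_conj (True, \<tau>) \<theta> = \<theta>' \<longleftrightarrow> (\<forall>x\<in>S. \<theta>' (\<tau> (\<theta> x)) = \<tau> x)"
    using *[OF permutes_inv[OF assms(2)]] by (simp add: signed_conj_def)
qed

text \<open>The product permutation is cut off outside the grid: \<open>map_prod\<close> would also move pairs with just
  one coordinate in range.\<close>

definition grid_perm :: "nat \<Rightarrow> nat \<Rightarrow> (nat \<Rightarrow> nat) \<Rightarrow> (nat \<Rightarrow> nat) \<Rightarrow> nat \<times> nat \<Rightarrow> nat \<times> nat" where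
  "grid_perm n m \<alpha> \<beta> = perm_restrict (map_prod \<alpha> \<beta>) (grid n m)"

definition grid_cross :: "nat \<Rightarrow> (nat \<Rightarrow> nat) \<Rightarrow> (nat \<Rightarrow> nat) \<Rightarrow> nat \<times> nat \<Rightarrow> nat \<times> nat" where
  "grid_cross n \<alpha> \<beta> = perm_restrict (cross \<alpha> \<beta>) (grid n n)"

definition symmetries :: "nat \<Rightarrow> nat \<Rightarrow> (bool \<times> (nat \<times> nat \<Rightarrow> nat \<times> nat)) set" where
  "symmetries n m =
    {(False, grid_perm n m \<alpha> \<beta>) |\<alpha> \<beta>. \<alpha> permutes {1..n} \<and> \<beta> permutes {1..m}} \<union>
    (if n = m then {(True, grid_cross n \<alpha> \<beta>) |\<alpha> \<beta>. \<alpha> permutes {1..n} \<and> \<beta> permutes {1..n}} else {})"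

lemma grid_perm_permutes:
  assumes "\<alpha> permutes {1..n}" "\<beta> permutes {1..m}"
  shows "grid_perm n m \<alpha> \<beta> permutes grid n m"
  unfolding grid_perm_def
proof (rule perm_restrict_permutes)
  show "inj_on (map_prod \<alpha> \<beta>) (grid n m)"
    using permutes_inj[OF assms(1)] permutes_inj[OF assms(2)]
    by (intro inj_on_subset[OF prod.inj_map]) auto
  show "map_prod \<alpha> \<beta> ` grid n m \<subseteq> grid n m"
    using permutes_in_image[OF assms(1)] permutes_in_image[OF assms(2)] by auto
qed simp

lemma grid_cross_permutes:
  assumes "\<alpha> permutes {1..n}" "\<beta> permutes {1..n}"
  shows "grid_cross n \<alpha> \<beta> permutes grid n n"
  unfolding grid_cross_def
proof (rule perm_restrict_permutes)
  show "inj_on (cross \<alpha> \<beta>) (grid n n)"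
    by (auto simp: inj_on_def cross_def inj_eq[OF permutes_inj[OF assms(1)]]
        inj_eq[OF permutes_inj[OF assms(2)]])
  show "cross \<alpha> \<beta> ` grid n n \<subseteq> grid n n"
    using permutes_in_image[OF assms(1)] permutes_in_image[OF assms(2)]
    by (simp add: cross_def image_subset_iff)
qed simp

lemma grid_perm_comp:
  assumes "\<gamma> permutes {1..n}" "\<delta> permutes {1..m}"
  shows "grid_perm n m \<alpha> \<beta> \<circ> grid_perm n m \<gamma> \<delta> = grid_perm n m (\<alpha> \<circ> \<gamma>) (\<beta> \<circ> \<delta>)"
  using permutes_in_image[OF assms(1)] permutes_in_image[OF assms(2)]
  by (auto simp: fun_eq_iff grid_perm_def perm_restrict_def)

lemma grid_cross_comp:
  assumes "\<gamma> permutes {1..n}" "\<delta> permutes {1..n}"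
  shows "grid_cross n \<alpha> \<beta> \<circ> grid_cross n \<gamma> \<delta> = grid_perm n n (\<beta> \<circ> \<gamma>) (\<alpha> \<circ> \<delta>)"
    and "grid_perm n n \<alpha> \<beta> \<circ> grid_cross n \<gamma> \<delta> = grid_cross n (\<beta> \<circ> \<gamma>) (\<alpha> \<circ> \<delta>)"
    and "grid_cross n \<alpha> \<beta> \<circ> grid_perm n n \<gamma> \<delta> = grid_cross n (\<alpha> \<circ> \<gamma>) (\<beta> \<circ> \<delta>)"
  using permutes_in_image[OF assms(1)] permutes_in_image[OF assms(2)]
  by (auto simp: fun_eq_iff grid_perm_def grid_cross_def cross_def perm_restrict_def)

lemma grid_perm_id: "grid_perm n m id id = id"
  by (auto simp: grid_perm_def perm_restrict_def fun_eq_iff)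

lemma symmetriesI:
  "\<alpha> permutes {1..n} \<Longrightarrow> \<beta> permutes {1..m} \<Longrightarrow> (False, grid_perm n m \<alpha> \<beta>) \<in> symmetries n m"
  "\<alpha> permutes {1..n} \<Longrightarrow> \<beta> permutes {1..n} \<Longrightarrow> (True, grid_cross n \<alpha> \<beta>) \<in> symmetries n n"
  unfolding symmetries_def by auto

lemma symmetriesE:
  assumes "k \<in> symmetries n m"
  obtains (relabel) \<alpha> \<beta> where "\<alpha> permutes {1..n}" "\<beta> permutes {1..m}" "k = (False, grid_perm n m \<alpha> \<beta>)"
  | (exchange) \<alpha> \<beta> where "n = m" "\<alpha> permutes {1..n}" "\<beta> permutes {1..n}" "k = (True, grid_cross n \<alpha> \<beta>)"
  using assms unfolding symmetries_def by (cases "n = m") auto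

lemma perm_inv_grid_perm:
  assumes "\<alpha> permutes {1..n}" "\<beta> permutes {1..m}"
  shows "perm_inv (grid_perm n m \<alpha> \<beta>) = grid_perm n m (perm_inv \<alpha>) (perm_inv \<beta>)"
  by (rule inv_unique_comp)
    (simp_all only: grid_perm_comp assms permutes_inv permutes_inv_o[OF assms(1)]
      permutes_inv_o[OF assms(2)] grid_perm_id)

lemma perm_inv_grid_cross:
  assumes "\<alpha> permutes {1..n}" "\<beta> permutes {1..n}"
  shows "perm_inv (grid_cross n \<alpha> \<beta>) = grid_cross n (perm_inv \<beta>) (perm_inv \<alpha>)"
  by (rule inv_unique_comp)
    (simp_all only: grid_cross_comp assms permutes_inv permutes_inv_o[OF assms(1)]
      permutes_inv_o[OF assms(2)] grid_perm_id)

lemma symmetries_group: "signed_perm_group (symmetries n m) (grid n m)"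
proof
  fix k assume k: "k \<in> symmetries n m"
  then show "snd k permutes grid n m"
    by (cases rule: symmetriesE) (simp_all only: snd_conv grid_perm_permutes grid_cross_permutes)
  show "(fst k, perm_inv (snd k)) \<in> symmetries n m"
    using k by (cases rule: symmetriesE)
      (simp_all only: fst_conv snd_conv perm_inv_grid_perm perm_inv_grid_cross permutes_inv symmetriesI)
  fix l assume l: "l \<in> symmetries n m"
  from k show "signed_mult k l \<in> symmetries n m"
  proof (cases rule: symmetriesE)
    case (relabel \<alpha> \<beta>)
    from l show ?thesis
    proof (cases rule: symmetriesE)
      case r: (relabel \<gamma> \<delta>)
      show ?thesis
        using relabel(1,2) r(1,2) symmetriesI(1)[of "\<alpha> \<circ> \<gamma>" n "\<beta> \<circ> \<delta>" m]
        by (simp only: relabel(3) r(3) signed_mult_def fst_conv snd_conv grid_perm_comp permutes_compose simp_thms)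
    next
      case r: (exchange \<gamma> \<delta>)
      show ?thesis
        using relabel(1,2) r(2,3) symmetriesI(2)[of "\<beta> \<circ> \<gamma>" n "\<alpha> \<circ> \<delta>"]
        by (simp only: relabel(3) r(4) r(1)[symmetric] signed_mult_def fst_conv snd_conv
            grid_cross_comp permutes_compose simp_thms)
    qed
  next
    case (exchange \<alpha> \<beta>)
    from l show ?thesis
    proof (cases rule: symmetriesE)
      case r: (relabel \<gamma> \<delta>)
      show ?thesis
        using exchange(2,3) r(1,2) symmetriesI(2)[of "\<alpha> \<circ> \<gamma>" n "\<beta> \<circ> \<delta>"]
        by (simp only: exchange(4) exchange(1)[symmetric] r(3) signed_mult_def fst_conv snd_conv
            grid_cross_comp permutes_compose simp_thms)
    next
      case r: (exchange \<gamma> \<delta>)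
      show ?thesis
        using exchange(2,3) r(2,3) symmetriesI(1)[of "\<beta> \<circ> \<gamma>" n "\<alpha> \<circ> \<delta>" n]
        by (simp only: exchange(4) exchange(1)[symmetric] r(4) signed_mult_def fst_conv snd_conv
            grid_cross_comp permutes_compose simp_thms)
    qed
  qed
next
  show "(False, id) \<in> symmetries n m"
    using symmetriesI(1)[OF permutes_id permutes_id] by (simp only: grid_perm_id)
qed

theorem semigroup_iso_iff:
  assumes \<theta>: "\<theta> permutes grid n m" "\<theta>' permutes grid n m" and pos: "0 < n" "0 < m"
  shows "theta_semigroup n m \<theta> \<cong> theta_semigroup n m \<theta>' \<longleftrightarrow>
    (\<exists>k\<in>symmetries n m. signed_conj k \<theta> = \<theta>')"
proof -
  have in_grid: "\<theta> x \<in> grid n m" if "x \<in> grid n m" for x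
    using that permutes_in_image[OF \<theta>(1)] by metis
  have P: "signed_conj (False, grid_perm n m \<alpha> \<beta>) \<theta> = \<theta>' \<longleftrightarrow>
      (\<forall>x\<in>grid n m. \<theta>' (map_prod \<alpha> \<beta> x) = map_prod \<alpha> \<beta> (\<theta> x))"
    if "\<alpha> permutes {1..n}" "\<beta> permutes {1..m}" for \<alpha> \<beta>
    unfolding signed_conj_eq_iff(1)[OF grid_perm_permutes[OF that] \<theta>]
    using in_grid by (intro ball_cong refl) (simp add: grid_perm_def perm_restrict_def)
  have Q: "signed_conj (True, grid_cross n \<alpha> \<beta>) \<theta> = \<theta>' \<longleftrightarrow>
      (\<forall>x\<in>grid n n. \<theta>' (cross \<alpha> \<beta> (\<theta> x)) = cross \<alpha> \<beta> x)"
    if "\<alpha> permutes {1..n}" "\<beta> permutes {1..n}" "n = m" for \<alpha> \<beta>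
    unfolding signed_conj_eq_iff(2)[OF grid_cross_permutes[OF that(1,2)] \<theta>[folded that(3)]]
    using in_grid that(3) by (intro ball_cong refl) (simp add: grid_cross_def perm_restrict_def)
  show ?thesis
  proof
    assume "theta_semigroup n m \<theta> \<cong> theta_semigroup n m \<theta>'"
    from iso_imp_relabelling_or_exchange[OF \<theta> pos this] show "\<exists>k\<in>symmetries n m. signed_conj k \<theta> = \<theta>'"
    proof (elim disjE exE conjE)
      fix \<alpha> \<beta> assume ab: "\<alpha> permutes {1..n}" "\<beta> permutes {1..m}"
        and "\<forall>x\<in>grid n m. \<theta>' (map_prod \<alpha> \<beta> x) = map_prod \<alpha> \<beta> (\<theta> x)"
      then have "signed_conj (False, grid_perm n m \<alpha> \<beta>) \<theta> = \<theta>'" using P by blast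
      then show ?thesis using symmetriesI(1)[OF ab] by blast
    next
      fix \<alpha> \<beta> assume ab: "n = m" "\<alpha> permutes {1..n}" "\<beta> permutes {1..n}"
        and "\<forall>x\<in>grid n n. \<theta>' (cross \<alpha> \<beta> (\<theta> x)) = cross \<alpha> \<beta> x"
      then have "signed_conj (True, grid_cross n \<alpha> \<beta>) \<theta> = \<theta>'" using Q by blast
      then show ?thesis using symmetriesI(2)[OF ab(2,3)] ab(1) by blast
    qed
  next
    assume "\<exists>k\<in>symmetries n m. signed_conj k \<theta> = \<theta>'"
    then obtain k where k: "k \<in> symmetries n m" "signed_conj k \<theta> = \<theta>'" by blast
    from k(1) show "theta_semigroup n m \<theta> \<cong> theta_semigroup n m \<theta>'"
    proof (cases rule: symmetriesE)
      case (relabel \<alpha> \<beta>)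
      then show ?thesis using relabel_iso[OF \<theta> relabel(1,2)] P k by blast
    next
      case (exchange \<alpha> \<beta>)
      then show ?thesis using exchange_iso[of \<theta> n \<theta>' \<alpha> \<beta>] \<theta> Q k by blast
    qed
  qed
qed

lemma class_degree_word_class:
  assumes "w \<in> words n m" shows "class_degree (word_class n m \<theta> w) = word_degree w"
proof -
  have "w \<in> word_class n m \<theta> w" by (rule equiv_class_self[OF equiv_word_cong assms])
  then have "(SOME v. v \<in> word_class n m \<theta> w) \<in> word_class n m \<theta> w" by (rule someI)
  then show ?thesis using word_cong_degree unfolding class_degree_def by force
qed

text \<open>The numbers of edges of a presented 2-graph are the parameters of the presentation; in
  particular the parameters can be recovered from the 2-graph.\<close>

lemma degree_fibres:
  "degree_fibre (theta_semigroup n m \<theta>, class_degree) (1, 0) = (\<lambda>i. {[Gen_e i]}) ` {1..n}"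
  "degree_fibre (theta_semigroup n m \<theta>, class_degree) (0, 1) = (\<lambda>j. {[Gen_f j]}) ` {1..m}"
proof -
  have deg: "degree_fibre (theta_semigroup n m \<theta>, class_degree) p =
      word_class n m \<theta> ` {w \<in> words n m. word_degree w = p}" for p
    by (auto simp: degree_fibre_def theta_semigroup_carrier class_degree_word_class)
  have one: "\<exists>a. w = [a]" if "fst (word_degree w) + snd (word_degree w) = 1" for w
    using that sum_length_filter_compl[of is_gen_e w]
    by (auto simp: word_degree_def length_Suc_conv)
  have "{w \<in> words n m. word_degree w = (1, 0)} = (\<lambda>i. [Gen_e i]) ` {1..n}"
  proof (intro equalityI subsetI)
    fix w assume w: "w \<in> {w \<in> words n m. word_degree w = (1, 0)}"
    then obtain a where "w = [a]" using one[of w] by auto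
    with w show "w \<in> (\<lambda>i. [Gen_e i]) ` {1..n}"
      by (cases a) (auto simp: word_degree_def words_gens gens_def)
  qed (auto simp: word_degree_def words_gens gens_def)
  then show "degree_fibre (theta_semigroup n m \<theta>, class_degree) (1, 0) = (\<lambda>i. {[Gen_e i]}) ` {1..n}"
    by (auto simp: deg image_image word_class_short words_gens gens_def intro!: image_cong)
  have "{w \<in> words n m. word_degree w = (0, 1)} = (\<lambda>i. [Gen_f i]) ` {1..m}"
  proof (intro equalityI subsetI)
    fix w assume w: "w \<in> {w \<in> words n m. word_degree w = (0, 1)}"
    then obtain a where "w = [a]" using one[of w] by auto
    with w show "w \<in> (\<lambda>i. [Gen_f i]) ` {1..m}"
      by (cases a) (auto simp: word_degree_def words_gens gens_def)
  qed (auto simp: word_degree_def words_gens gens_def)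
  then show "degree_fibre (theta_semigroup n m \<theta>, class_degree) (0, 1) = (\<lambda>j. {[Gen_f j]}) ` {1..m}"
    by (auto simp: deg image_image word_class_short words_gens gens_def intro!: image_cong)
qed

lemma single_vertex_2graphs_eq:
  "single_vertex_2graphs n m = (\<lambda>\<theta>. (theta_semigroup n m \<theta>, class_degree)) ` {\<theta>. \<theta> permutes grid n m}"
proof -
  have "card ((\<lambda>i. {[Gen_e i]}) ` {1..N}) = N" "card ((\<lambda>i. {[Gen_f i]}) ` {1..N}) = N" for N
    by (simp_all add: card_image inj_on_def)
  then show ?thesis
    unfolding single_vertex_2graphs_def single_vertex_2graph_def
    by (auto simp: degree_fibres simp del: One_nat_def)
qed

theorem O_count_burnside:
  assumes "0 < n" "0 < m"
  shows "O_count n m * card (symmetries n m) =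
    (\<Sum>k\<in>symmetries n m. card {\<theta>. \<theta> permutes grid n m \<and> signed_conj k \<theta> = \<theta>})"
proof -
  interpret signed_perm_group "symmetries n m" "grid n m" by (rule symmetries_group)
  show ?thesis
    unfolding O_count_def single_vertex_2graphs_eq
    by (rule card_signed_classes)
      (use semigroup_iso_iff assms in \<open>auto simp: graph2_iso_def single_vertex_2graphs_eq\<close>)
qed

section \<open>Fixed points and cycle types\<close>

lemma funpow_grid_perm:
  assumes "\<alpha> permutes {1..n}" "\<beta> permutes {1..m}" "(i, j) \<in> grid n m"
  shows "(grid_perm n m \<alpha> \<beta> ^^ k) (i, j) = ((\<alpha> ^^ k) i, (\<beta> ^^ k) j)"
proof -
  have "\<alpha> ` {1..n} \<subseteq> {1..n}" "\<beta> ` {1..m} \<subseteq> {1..m}"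
    using permutes_image[OF assms(1)] permutes_image[OF assms(2)] by simp_all
  then have "(\<alpha> ^^ k) i \<in> {1..n}" "(\<beta> ^^ k) j \<in> {1..m}" for k
    using assms(3) by (simp_all only: mem_Times_iff fst_conv snd_conv funpow_in_invariant)
  then show ?thesis
    by (induction k) (simp_all add: grid_perm_def perm_restrict_def)
qed

text \<open>The \<open>k\<close>-th power fixes \<open>(i, j)\<close> iff \<open>k\<close> is a multiple of both periods.\<close>

lemma least_power_grid_perm:
  assumes "\<alpha> permutes {1..n}" "\<beta> permutes {1..m}" "(i, j) \<in> grid n m"
  shows "least_power (grid_perm n m \<alpha> \<beta>) (i, j) = lcm (least_power \<alpha> i) (least_power \<beta> j)"
proof -
  have perm: "permutation \<alpha>" "permutation \<beta>" "permutation (grid_perm n m \<alpha> \<beta>)"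
    using assms(1,2) grid_perm_permutes[OF assms(1,2)] permutation_permutes
    by (metis finite_atLeastAtMost finite_cartesian_product)+
  have "least_power (grid_perm n m \<alpha> \<beta>) (i, j) dvd k \<longleftrightarrow> lcm (least_power \<alpha> i) (least_power \<beta> j) dvd k" for k
    by (simp only: least_power_dvd perm funpow_grid_perm[OF assms] lcm_least_iff prod.inject)
  then show ?thesis by (meson dvd_antisym dvd_refl)
qed

text \<open>A cycle of length \<open>k\<close> is recorded as \<open>k\<close> copies of the number \<open>k\<close>, one for each of its points.\<close>

definition cycle_type :: "nat \<Rightarrow> (nat \<Rightarrow> nat) \<Rightarrow> nat multiset" where
  "cycle_type n \<alpha> = image_mset (least_power \<alpha>) (mset_set {1..n})"

text \<open>The cycle type of a product permutation, computed from those of its factors.\<close>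

definition product_cycle_type :: "nat multiset \<Rightarrow> nat multiset \<Rightarrow> nat multiset" where
  "product_cycle_type P Q = (\<Sum>p\<in>#P. image_mset (lcm p) Q)"

definition cycle_factor :: "nat multiset \<Rightarrow> nat \<Rightarrow> nat" where
  "cycle_factor P k = k ^ (count P k div k) * fact (count P k div k)"

definition centralizer_order :: "nat multiset \<Rightarrow> nat" where
  "centralizer_order P = prod (cycle_factor P) (set_mset P)"

lemma count_image_mset_set:
  "finite A \<Longrightarrow> count (image_mset f (mset_set A)) k = card {x \<in> A. f x = k}"
  by (simp add: count_image_mset' conj_commute eq_commute)

lemma image_mset_times:
  assumes "finite A" "finite B"
  shows "image_mset (\<lambda>(x, y). lcm (f x) (g y)) (mset_set (A \<times> B)) =
    (\<Sum>p\<in>#image_mset f (mset_set A). image_mset (lcm p) (image_mset g (mset_set B)))"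
  using assms(1)
proof (induction A rule: finite_induct)
  case (insert a A)
  have "insert a A \<times> B = Pair a ` B \<union> A \<times> B" by auto
  moreover have "mset_set (Pair a ` B \<union> A \<times> B) = mset_set (Pair a ` B) + mset_set (A \<times> B)"
    using insert.hyps assms(2) by (intro mset_set_Union) auto
  moreover have "mset_set (Pair a ` B) = image_mset (Pair a) (mset_set B)"
    by (rule image_mset_mset_set[symmetric]) (simp add: inj_on_def)
  ultimately show ?case
    using insert by (simp add: image_mset.compositionality comp_def)
qed simp

lemma card_commutants_grid:
  assumes "\<alpha> permutes {1..n}" "\<beta> permutes {1..m}"
  shows "card (commutants (grid_perm n m \<alpha> \<beta>) (grid n m)) =
    centralizer_order (product_cycle_type (cycle_type n \<alpha>) (cycle_type m \<beta>))"
proof -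
  let ?h = "grid_perm n m \<alpha> \<beta>"
  define P where "P = image_mset (least_power ?h) (mset_set (grid n m))"
  have h: "?h permutes grid n m" by (rule grid_perm_permutes[OF assms])
  have fin: "finite (grid n m)" by simp
  have perm: "permutation ?h" using h fin permutation_permutes by blast
  have "P = image_mset (\<lambda>(i, j). lcm (least_power \<alpha> i) (least_power \<beta> j)) (mset_set (grid n m))"
    unfolding P_def using least_power_grid_perm[OF assms]
    by (intro image_mset_cong) (auto simp del: One_nat_def)
  then have P: "P = product_cycle_type (cycle_type n \<alpha>) (cycle_type m \<beta>)"
    by (simp only: image_mset_times finite_atLeastAtMost product_cycle_type_def cycle_type_def)
  have "cycle_count ?h (grid n m) k = count P k div k" for k
    unfolding cycle_count_def P_def count_image_mset_set[OF fin] ..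
  moreover have "set_mset P = least_power ?h ` grid n m"
    unfolding P_def using fin by simp
  ultimately show ?thesis
    using card_commutants[OF perm _ fin, of "set_mset P"] permutes_image[OF h]
    unfolding centralizer_order_def P[symmetric] by (simp add: cycle_factor_def)
qed

lemma fixed_points_relabelling:
  assumes "\<tau> permutes S"
  shows "{\<theta>. \<theta> permutes S \<and> signed_conj (False, \<tau>) \<theta> = \<theta>} = commutants \<tau> S"
proof -
  have "(\<forall>x\<in>S. \<theta> (\<tau> x) = \<tau> (\<theta> x)) \<longleftrightarrow> \<theta> \<circ> \<tau> = \<tau> \<circ> \<theta>" if "\<theta> permutes S" for \<theta>
    unfolding fun_eq_iff comp_apply
    using permutes_not_in[OF assms] permutes_not_in[OF that] by metis
  then show ?thesis
    using signed_conj_eq_iff(1)[OF assms] unfolding commutants_def by blast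
qed

abbreviation perms :: "nat \<Rightarrow> (nat \<Rightarrow> nat) set" where
  "perms n \<equiv> {\<alpha>. \<alpha> permutes {1..n}}"

lemma card_perms: "card (perms n) = fact n"
  by (rule card_permutations) simp_all

lemma inj_grid_perm:
  assumes "0 < n" "0 < m"
  shows "inj_on (\<lambda>(\<alpha>, \<beta>). grid_perm n m \<alpha> \<beta>) (perms n \<times> perms m)"
proof (rule inj_onI, clarify)
  fix \<alpha> \<beta> \<alpha>' \<beta>'
  assume p: "\<alpha> permutes {1..n}" "\<beta> permutes {1..m}" "\<alpha>' permutes {1..n}" "\<beta>' permutes {1..m}"
    and eq: "grid_perm n m \<alpha> \<beta> = grid_perm n m \<alpha>' \<beta>'"
  have "\<alpha> i = \<alpha>' i \<and> \<beta> j = \<beta>' j" if "i \<in> {1..n}" "j \<in> {1..m}" for i j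
    using fun_cong[OF eq, of "(i, j)"] that by (simp add: grid_perm_def perm_restrict_def)
  moreover have "1 \<in> {1..n}" "1 \<in> {1..m}" using assms by auto
  ultimately show "\<alpha> = \<alpha>' \<and> \<beta> = \<beta>'"
    using p permutes_not_in unfolding fun_eq_iff by metis
qed

lemma inj_grid_cross:
  assumes "0 < n"
  shows "inj_on (\<lambda>(\<alpha>, \<beta>). grid_cross n \<alpha> \<beta>) (perms n \<times> perms n)"
proof (rule inj_onI, clarify)
  fix \<alpha> \<beta> \<alpha>' \<beta>'
  assume p: "\<alpha> permutes {1..n}" "\<beta> permutes {1..n}" "\<alpha>' permutes {1..n}" "\<beta>' permutes {1..n}"
    and eq: "grid_cross n \<alpha> \<beta> = grid_cross n \<alpha>' \<beta>'"
  have "\<alpha> i = \<alpha>' i \<and> \<beta> j = \<beta>' j" if "i \<in> {1..n}" "j \<in> {1..n}" for i j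
    using fun_cong[OF eq, of "(i, j)"] that by (simp add: grid_cross_def cross_def perm_restrict_def)
  moreover have "1 \<in> {1..n}" using assms by auto
  ultimately show "\<alpha> = \<alpha>' \<and> \<beta> = \<beta>'"
    using p permutes_not_in unfolding fun_eq_iff by metis
qed

text \<open>The colour-preserving symmetries are parametrised injectively by pairs of permutations, since the
  grid is nonempty in both directions.\<close>

lemma relabelling_sum:
  assumes "0 < n" "0 < m"
  defines "R \<equiv> (\<lambda>(\<alpha>, \<beta>). (False, grid_perm n m \<alpha> \<beta>)) ` (perms n \<times> perms m)"
  shows "card R = fact n * fact m"
    and "(\<Sum>k\<in>R. card {\<theta>. \<theta> permutes grid n m \<and> signed_conj k \<theta> = \<theta>}) =
      (\<Sum>\<alpha>\<in>perms n. \<Sum>\<beta>\<in>perms m.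
        centralizer_order (product_cycle_type (cycle_type n \<alpha>) (cycle_type m \<beta>)))"
proof -
  have inj: "inj_on (\<lambda>(\<alpha>, \<beta>). (False, grid_perm n m \<alpha> \<beta>)) (perms n \<times> perms m)"
    using inj_grid_perm[OF assms(1,2)] by (auto simp: inj_on_def simp del: One_nat_def)
  show "card R = fact n * fact m"
    unfolding R_def card_image[OF inj] by (simp only: card_cartesian_product card_perms)
  show "(\<Sum>k\<in>R. card {\<theta>. \<theta> permutes grid n m \<and> signed_conj k \<theta> = \<theta>}) =
      (\<Sum>\<alpha>\<in>perms n. \<Sum>\<beta>\<in>perms m.
        centralizer_order (product_cycle_type (cycle_type n \<alpha>) (cycle_type m \<beta>)))"
    unfolding R_def sum.reindex[OF inj] sum.cartesian_product
    by (intro sum.cong refl)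
      (auto simp: fixed_points_relabelling grid_perm_permutes card_commutants_grid simp del: One_nat_def)
qed

theorem O_count_distinct:
  assumes "0 < n" "0 < m" "n \<noteq> m"
  shows "O_count n m * (fact n * fact m) = (\<Sum>\<alpha>\<in>perms n. \<Sum>\<beta>\<in>perms m.
    centralizer_order (product_cycle_type (cycle_type n \<alpha>) (cycle_type m \<beta>)))"
proof -
  have "symmetries n m = (\<lambda>(\<alpha>, \<beta>). (False, grid_perm n m \<alpha> \<beta>)) ` (perms n \<times> perms m)"
    using assms(3) by (auto simp: symmetries_def image_def)
  then show ?thesis
    using O_count_burnside[OF assms(1,2)] relabelling_sum[OF assms(1,2)] by simp
qed

theorem O_count_equal:
  assumes "0 < n"
  shows "O_count n n * (2 * (fact n * fact n)) =
    (\<Sum>\<alpha>\<in>perms n. \<Sum>\<beta>\<in>perms n.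
      centralizer_order (product_cycle_type (cycle_type n \<alpha>) (cycle_type n \<beta>))) +
    (\<Sum>\<alpha>\<in>perms n. \<Sum>\<beta>\<in>perms n.
      card {\<theta>. \<theta> permutes grid n n \<and> (\<forall>x\<in>grid n n. \<theta> (cross \<alpha> \<beta> (\<theta> x)) = cross \<alpha> \<beta> x)})"
proof -
  define R where "R = (\<lambda>(\<alpha>, \<beta>). (False, grid_perm n n \<alpha> \<beta>)) ` (perms n \<times> perms n)"
  define X where "X = (\<lambda>(\<alpha>, \<beta>). (True, grid_cross n \<alpha> \<beta>)) ` (perms n \<times> perms n)"
  let ?fix = "\<lambda>k. card {\<theta>. \<theta> permutes grid n n \<and> signed_conj k \<theta> = \<theta>}"
  have sym: "symmetries n n = R \<union> X"
    by (auto simp: symmetries_def image_def R_def X_def)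
  have fin: "finite (perms n)" by (simp add: finite_permutations)
  have disj: "finite R" "finite X" "R \<inter> X = {}"
    using fin by (auto simp: R_def X_def simp del: One_nat_def)
  have inj: "inj_on (\<lambda>(\<alpha>, \<beta>). (True, grid_cross n \<alpha> \<beta>)) (perms n \<times> perms n)"
    using inj_grid_cross[OF assms] by (auto simp: inj_on_def simp del: One_nat_def)
  have X: "card X = fact n * fact n"
    unfolding X_def card_image[OF inj] by (simp only: card_cartesian_product card_perms)
  have fixX: "{\<theta>. \<theta> permutes grid n n \<and> signed_conj (True, grid_cross n \<alpha> \<beta>) \<theta> = \<theta>} =
      {\<theta>. \<theta> permutes grid n n \<and> (\<forall>x\<in>grid n n. \<theta> (cross \<alpha> \<beta> (\<theta> x)) = cross \<alpha> \<beta> x)}"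
    if "\<alpha> permutes {1..n}" "\<beta> permutes {1..n}" for \<alpha> \<beta>
  proof (intro Collect_cong conj_cong refl)
    fix \<theta> assume \<theta>: "\<theta> permutes grid n n"
    then have "\<theta> x \<in> grid n n" if "x \<in> grid n n" for x
      using that permutes_in_image[OF \<theta>] by metis
    then show "signed_conj (True, grid_cross n \<alpha> \<beta>) \<theta> = \<theta> \<longleftrightarrow>
        (\<forall>x\<in>grid n n. \<theta> (cross \<alpha> \<beta> (\<theta> x)) = cross \<alpha> \<beta> x)"
      unfolding signed_conj_eq_iff(2)[OF grid_cross_permutes[OF that] \<theta> \<theta>]
      by (intro ball_cong refl) (simp add: grid_cross_def perm_restrict_def)
  qed
  have "(\<Sum>k\<in>X. ?fix k) = (\<Sum>\<alpha>\<in>perms n. \<Sum>\<beta>\<in>perms n.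
      card {\<theta>. \<theta> permutes grid n n \<and> (\<forall>x\<in>grid n n. \<theta> (cross \<alpha> \<beta> (\<theta> x)) = cross \<alpha> \<beta> x)})"
    unfolding X_def sum.reindex[OF inj] sum.cartesian_product
    by (intro sum.cong refl) (auto simp: fixX simp del: One_nat_def)
  moreover have "O_count n n * (card R + card X) = (\<Sum>k\<in>R. ?fix k) + (\<Sum>k\<in>X. ?fix k)"
    using O_count_burnside[OF assms assms] unfolding sym
    by (simp only: card_Un_disjoint[OF disj] sum.union_disjoint[OF disj])
  ultimately show ?thesis
    using relabelling_sum[OF assms assms] X unfolding R_def by (simp add: algebra_simps)
qed

section \<open>Evaluation for the three sizes\<close>

text \<open>An evaluable form of the period on at most four points, where a point whose period is not
  1, 2 or 3 has period 4.\<close>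

definition short_period :: "('a \<Rightarrow> 'a) \<Rightarrow> 'a \<Rightarrow> nat" where
  "short_period p x =
    (if p x = x then 1 else if p (p x) = x then 2 else if p (p (p x)) = x then 3 else 4)"

lemma least_power_eq_short_period:
  assumes p: "p permutes S" "finite S" "card S \<le> 4"
  shows "least_power p x = short_period p x"
proof -
  have perm: "permutation p" using p permutation_permutes by blast
  have pos: "0 < least_power p x" by (rule least_power_of_permutation[OF perm])
  have dvd: "least_power p x dvd 1 \<longleftrightarrow> p x = x" "least_power p x dvd 2 \<longleftrightarrow> p (p x) = x"
    "least_power p x dvd 3 \<longleftrightarrow> p (p (p x)) = x"
    unfolding least_power_dvd[OF perm] by (simp_all add: numeral_2_eq_2 numeral_3_eq_3)
  have "least_power p x \<le> 4"
  proof (cases "x \<in> S")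
    case True
    have "set (support p x) \<subseteq> S"
      using funpow_in_invariant[of p S x] permutes_image[OF p(1)] True by auto
    then have "card (set (support p x)) \<le> 4"
      using card_mono[OF p(2)] p(3) by (meson le_trans)
    then show ?thesis
      using distinct_card[OF cycle_of_permutation[OF perm, of x]] by simp
  next
    case False
    then show ?thesis using dvd(1) permutes_not_in[OF p(1)] by simp
  qed
  with pos consider "least_power p x = 1" | "least_power p x = 2" | "least_power p x = 3" | "least_power p x = 4"
    by linarith
  then show ?thesis
    unfolding short_period_def by cases (use dvd in \<open>auto split: if_splits\<close>)
qed

lemma sum_cycle_types:
  assumes "n \<le> 4"
  shows "(\<Sum>\<alpha>\<in>perms n. F (cycle_type n \<alpha>)) =
    (\<Sum>\<alpha>\<in>perms n. F (image_mset (short_period \<alpha>) (mset_set {1..n})))"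
  unfolding cycle_type_def
  by (intro sum.cong refl arg_cong[where f = F] image_mset_cong least_power_eq_short_period[of _ "{1..n}"])
    (use assms in simp_all)

lemma interval_2: "{1..2::nat} = {1, 2}"
  and interval_3: "{1..3::nat} = {1, 2, 3}"
  and interval_4: "{1..4::nat} = {1, 2, 3, 4}"
  by auto

lemma sum_perms_2: "(\<Sum>\<alpha>\<in>perms 2. f \<alpha>) = f id + f (transpose 1 2)"
  unfolding interval_2 by (simp add: sum_over_permutations_insert del: One_nat_def)

lemma sum_cycle_types_2: "(\<Sum>\<alpha>\<in>perms 2. F (cycle_type 2 \<alpha>)) = F {#1, 1#} + (F {#2, 2#} :: nat)"
  by (subst sum_cycle_types, simp)
    (simp add: interval_2 sum_over_permutations_insert short_period_def transpose_def del: One_nat_def)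

lemma sum_cycle_types_3:
  "(\<Sum>\<alpha>\<in>perms 3. F (cycle_type 3 \<alpha>)) = F {#1, 1, 1#} + 3 * F {#1, 2, 2#} + (2 * F {#3, 3, 3#} :: nat)"
  by (subst sum_cycle_types, simp)
    (simp add: interval_3 sum_over_permutations_insert short_period_def transpose_def add_mset_commute
      del: One_nat_def)

text \<open>The coefficients are the sizes of the conjugacy classes of the symmetric group on four
  letters.\<close>

lemma sum_cycle_types_4:
  "(\<Sum>\<alpha>\<in>perms 4. F (cycle_type 4 \<alpha>)) = F {#1, 1, 1, 1#} + 6 * F {#1, 1, 2, 2#} + 3 * F {#2, 2, 2, 2#} +
    8 * F {#1, 3, 3, 3#} + (6 * F {#4, 4, 4, 4#} :: nat)"
  by (subst sum_cycle_types, simp)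
    (simp add: interval_4 sum_over_permutations_insert short_period_def transpose_def add_mset_commute
      del: One_nat_def)

lemma small_lcm: "lcm 2 3 = (6::nat)" "lcm 3 2 = (6::nat)" "lcm 2 4 = (4::nat)" "lcm 3 4 = (12::nat)"
  by (simp_all add: lcm_nat_def gcd_non_0_nat)

text \<open>Multiplicities computed with this equation are numerals, whereas the default equation
  yields successor terms on which large factorials cannot be evaluated.\<close>

lemma count_add_mset_plus: "count (add_mset x M) y = (if x = y then 1 + count M y else count M y)"
  by simp

lemmas centralizer_order_eval = count_add_mset_plus product_cycle_type_def centralizer_order_def cycle_factor_def small_lcm fact_numeral prod.insert_if

lemma O_count_2_3: "O_count 2 3 = 84"
proof -
  have "O_count 2 3 * (fact 2 * fact 3) = (\<Sum>\<alpha>\<in>perms 2. \<Sum>\<beta>\<in>perms 3.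
      centralizer_order (product_cycle_type (cycle_type 2 \<alpha>) (cycle_type 3 \<beta>)))"
    by (rule O_count_distinct) simp_all
  also have "\<dots> = 1008"
    unfolding sum_cycle_types_2[of "\<lambda>P. \<Sum>\<beta>\<in>perms 3. centralizer_order (product_cycle_type P (cycle_type 3 \<beta>))"]
    unfolding sum_cycle_types_3[of "\<lambda>Q. centralizer_order (product_cycle_type P Q)" for P]
    by (simp add: centralizer_order_eval del: One_nat_def prod.insert count_add_mset)
  finally show ?thesis by (simp add: fact_numeral)
qed

lemma O_count_3_4: "O_count 3 4 = 3333212"
proof -
  have "O_count 3 4 * (fact 3 * fact 4) = (\<Sum>\<alpha>\<in>perms 3. \<Sum>\<beta>\<in>perms 4.
      centralizer_order (product_cycle_type (cycle_type 3 \<alpha>) (cycle_type 4 \<beta>)))"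
    by (rule O_count_distinct) simp_all
  also have "\<dots> = 479982528"
    unfolding sum_cycle_types_3[of "\<lambda>P. \<Sum>\<beta>\<in>perms 4. centralizer_order (product_cycle_type P (cycle_type 4 \<beta>))"]
    unfolding sum_cycle_types_4[of "\<lambda>Q. centralizer_order (product_cycle_type P Q)" for P]
    by (simp add: centralizer_order_eval del: One_nat_def prod.insert count_add_mset)
  finally show ?thesis by (simp add: fact_numeral)
qed

lemma grid_2_2: "grid 2 2 = {(1,1), (1,2), (2,1), (2,2)}"
  unfolding interval_2 by auto

lemma card_as_sum: "finite A \<Longrightarrow> card {x \<in> A. P x} = (\<Sum>x\<in>A. if P x then 1 else 0)"
  by (simp add: sum.If_cases Int_def)

text \<open>With \<open>\<tau>\<close> the exchange, a fixed point \<open>\<theta>\<close> corresponds to the square root \<open>\<theta> \<tau>\<close> of \<open>\<tau>\<^sup>2\<close>. For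
  \<open>\<alpha> = \<beta>\<close> the square of \<open>\<tau>\<close> is the identity, which has 10 square roots on four points; otherwise
  it is a product of two disjoint transpositions, which has 2. The proof tests all 24
  permutations for each of the four exchanges.\<close>

lemma fixed_points_exchange_2:
  "(\<Sum>\<alpha>\<in>perms 2. \<Sum>\<beta>\<in>perms 2.
      card {\<theta>. \<theta> permutes grid 2 2 \<and> (\<forall>x\<in>grid 2 2. \<theta> (cross \<alpha> \<beta> (\<theta> x)) = cross \<alpha> \<beta> x)}) = 24"
proof -
  have c: "card {\<theta>. \<theta> permutes grid 2 2 \<and> Q \<theta>} = (\<Sum>\<theta> | \<theta> permutes grid 2 2. if Q \<theta> then 1 else 0)" for Q
    using card_as_sum[of "{\<theta>. \<theta> permutes grid 2 2}" Q] by (simp add: finite_permutations)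
  show ?thesis
    \<comment> \<open>The outer sums come first, so that the candidates are tested against concrete exchanges.\<close>
    unfolding sum_perms_2 c unfolding grid_2_2
    by (simp add: sum_over_permutations_insert transpose_def cross_def del: One_nat_def)
qed

lemma O_count_2_2: "O_count 2 2 = 9"
proof -
  have "O_count 2 2 * (2 * (fact 2 * fact 2)) = (\<Sum>\<alpha>\<in>perms 2. \<Sum>\<beta>\<in>perms 2.
      centralizer_order (product_cycle_type (cycle_type 2 \<alpha>) (cycle_type 2 \<beta>))) + 24"
    using O_count_equal[of 2] unfolding fixed_points_exchange_2 by simp
  also have "\<dots> = 72"
    unfolding sum_cycle_types_2[of "\<lambda>P. \<Sum>\<beta>\<in>perms 2. centralizer_order (product_cycle_type P (cycle_type 2 \<beta>))"]
    unfolding sum_cycle_types_2[of "\<lambda>Q. centralizer_order (product_cycle_type P Q)" for P]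
    by (simp add: centralizer_order_eval del: One_nat_def prod.insert count_add_mset)
  finally show ?thesis by (simp add: fact_numeral)
qed

theorem proposition3p1:
  shows "O_count 2 2 = 9 \<and> O_count 2 3 = 84 \<and> O_count 3 4 = 3333212"
  using O_count_2_2 O_count_2_3 O_count_3_4 by blast

end
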